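(* Let $(\Gamma,\gamma)$ be a spin network such that $\Gamma$ has no trivial components. Then $|\langle\Gamma,n\gamma\rangle^U|$ grows at most polynomially in $n$: there exist constants $C>0$ and $k\ge 0$ such that $|\langle\Gamma,n\gamma\rangle^U|\le C(1+n)^k$ for all integers $n\ge 0$.
   Context: A cubic ribbon graph $\Gamma=(G,R)$ consists of a finite graph $G$ in which every vertex has degree $3$ (multiple edges and loops allowed, a loop counting $2$ towards the degree; $G$ may be disconnected; $G$ may contain "trivial components", each a single edge closing on itself with no vertex), together with a cyclic ordering $R$ of the half-edges at each vertex, determining an embedding of $G$ into a closed orientable surface $\Sigma$. A decoration $\gamma:E(G)\to\{0,1,2,\dots\}$ is admissible if at every vertex with incident decorations $a,b,c$ (loop counted twice) $a+b+c$ is even and $|a-b|\le c\le a+b$; a spin network is $(\Gamma,\gamma)$ with $\gamma$ admissible; $n\gamma$ denotes the decoration $e\mapsto n\gamma(e)$. Penrose evaluation: on the thickened embedded graph replace each edge $e$ by $\gamma(e)$ parallel strands; at each vertex with decorations $a,b,c$ connect strands without crossings, $\frac{a+b-c}{2}$ between the $a$- and $b$-edges, $\frac{a+c-b}{2}$ between $a$ and $c$, $\frac{b+c-a}{2}$ between $b$ and $c$; on each edge insert a permutation $\sigma_e\in\mathfrak S_{\gamma(e)}$ of the strands; with $N(\vec\sigma)$ the number of resulting closed curves, $\langle\Gamma,\gamma\rangle^P=\sum_{\vec\sigma}(\prod_e\mathrm{sign}\,\sigma_e)(-2)^{N(\vec\sigma)}$. Unitary evaluation: $\langle\Gamma,\gamma\rangle^U=\langle\Gamma,\gamma\rangle^P\prod_{v}\big[(\tfrac{a_v+b_v+c_v}{2}+1)!\,(\tfrac{a_v+b_v-c_v}{2})!\,(\tfrac{a_v+c_v-b_v}{2})!\,(\tfrac{b_v+c_v-a_v}{2})!\big]^{-1/2}$,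 where $a_v,b_v,c_v$ are the decorations at vertex $v$ (loop counted twice). *)

theory Defs
  imports Complex_Main "HOL-Combinatorics.Permutations"
begin

text \<open>
  A cubic ribbon graph without trivial components is encoded combinatorially.
  Edges form a finite set E of an arbitrary type; every edge e has two ends
  (half-edges) (e, False) and (e, True), so the half-edge set is E \<times> UNIV.
  R is the rotation: it permutes the half-edges, and every orbit of R has size
  exactly 3; the orbits are the vertices and R gives the cyclic order of the
  three half-edges around a vertex.  Loops and multiple edges are allowed, and
  the graph may be disconnected.  The orientation of an edge (which end is
  called False) is auxiliary and does not influence the evaluation.
\<close>

definition half_edges :: "'e set \<Rightarrow> ('e \<times> bool) set" where
  "half_edges E = E \<times> (UNIV :: bool set)"

definition cubic_ribbon_graph :: "'e set \<Rightarrow> ('e \<times> bool \<Rightarrow> 'e \<times> bool) \<Rightarrow> bool" where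
  "cubic_ribbon_graph E R \<longleftrightarrow> finite E \<and> R permutes half_edges E \<and>
     (\<forall>h \<in> half_edges E. R h \<noteq> h \<and> R (R (R h)) = h)"

text \<open>Vertices: the orbits of R.\<close>
definition vertices :: "'e set \<Rightarrow> ('e \<times> bool \<Rightarrow> 'e \<times> bool) \<Rightarrow> ('e \<times> bool) set set" where
  "vertices E R = {{h, R h, R (R h)} | h. h \<in> half_edges E}"

text \<open>Admissibility at every vertex (checked at every half-edge h, with
  a, b, c the decorations of h, R h, R (R h); loops are thus counted twice).\<close>
definition admissible :: "'e set \<Rightarrow> ('e \<times> bool \<Rightarrow> 'e \<times> bool) \<Rightarrow> ('e \<Rightarrow> nat) \<Rightarrow> bool" where
  "admissible E R \<gamma> \<longleftrightarrow> (\<forall>h \<in> half_edges E.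
     (let a = \<gamma> (fst h); b = \<gamma> (fst (R h)); c = \<gamma> (fst (R (R h))) in
       even (a + b + c) \<and> \<bar>int a - int b\<bar> \<le> int c \<and> c \<le> a + b))"

definition spin_network :: "'e set \<Rightarrow> ('e \<times> bool \<Rightarrow> 'e \<times> bool) \<Rightarrow> ('e \<Rightarrow> nat) \<Rightarrow> bool" where
  "spin_network E R \<gamma> \<longleftrightarrow> cubic_ribbon_graph E R \<and> admissible E R \<gamma>"

text \<open>Strand endpoints: (h, i) with h a half-edge and i < decoration of its edge;
  i is the position of the strand, counted counterclockwise around the vertex.\<close>
definition strand_ends :: "'e set \<Rightarrow> ('e \<Rightarrow> nat) \<Rightarrow> (('e \<times> bool) \<times> nat) set" where
  "strand_ends E \<gamma> = {(h, i). h \<in> half_edges E \<and> i < \<gamma> (fst h)}"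

text \<open>Crossingless connection inside a vertex: with a, b, c the decorations of
  h, R h, R (R h), the first (a+c-b)/2 strands of h go to the last ones of R (R h),
  the last (a+b-c)/2 strands of h go to the first ones of R h (nested arcs).\<close>
definition vertex_partner ::
  "('e \<times> bool \<Rightarrow> 'e \<times> bool) \<Rightarrow> ('e \<Rightarrow> nat) \<Rightarrow> ('e \<times> bool) \<times> nat \<Rightarrow> ('e \<times> bool) \<times> nat" where
  "vertex_partner R \<gamma> x = (case x of (h, i) \<Rightarrow>
     (let a = \<gamma> (fst h); b = \<gamma> (fst (R h)); c = \<gamma> (fst (R (R h))) in
       if i < (a + c - b) div 2 then (R (R h), c - 1 - i) else (R h, a - 1 - i)))"

text \<open>Along an edge (untwisted band), parallel strands join position i at one end
  with position m - 1 - i at the other end; the permutation \<sigma> e is inserted.\<close>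
definition edge_links ::
  "'e set \<Rightarrow> ('e \<Rightarrow> nat) \<Rightarrow> ('e \<Rightarrow> nat \<Rightarrow> nat) \<Rightarrow> ((('e \<times> bool) \<times> nat) \<times> (('e \<times> bool) \<times> nat)) set" where
  "edge_links E \<gamma> \<sigma> = {(((e, False), i), ((e, True), \<gamma> e - 1 - \<sigma> e i)) | e i. e \<in> E \<and> i < \<gamma> e}"

definition vertex_links ::
  "'e set \<Rightarrow> ('e \<times> bool \<Rightarrow> 'e \<times> bool) \<Rightarrow> ('e \<Rightarrow> nat) \<Rightarrow> ((('e \<times> bool) \<times> nat) \<times> (('e \<times> bool) \<times> nat)) set" where
  "vertex_links E R \<gamma> = {(x, vertex_partner R \<gamma> x) | x. x \<in> strand_ends E \<gamma>}"

text \<open>Number of closed curves: connected components of the strand diagram.\<close>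
definition num_curves ::
  "'e set \<Rightarrow> ('e \<times> bool \<Rightarrow> 'e \<times> bool) \<Rightarrow> ('e \<Rightarrow> nat) \<Rightarrow> ('e \<Rightarrow> nat \<Rightarrow> nat) \<Rightarrow> nat" where
  "num_curves E R \<gamma> \<sigma> =
     (let L = vertex_links E R \<gamma> \<union> edge_links E \<gamma> \<sigma> in
       card (strand_ends E \<gamma> // ((L \<union> L\<inverse>)\<^sup>*)))"

definition edge_perms :: "'e set \<Rightarrow> ('e \<Rightarrow> nat) \<Rightarrow> ('e \<Rightarrow> nat \<Rightarrow> nat) set" where
  "edge_perms E \<gamma> = (\<Pi>\<^sub>E e \<in> E. {p. p permutes {..<\<gamma> e}})"

definition penrose_eval :: "'e set \<Rightarrow> ('e \<times> bool \<Rightarrow> 'e \<times> bool) \<Rightarrow> ('e \<Rightarrow> nat) \<Rightarrow> int" where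
  "penrose_eval E R \<gamma> =
     (\<Sum>\<sigma> \<in> edge_perms E \<gamma>. (\<Prod>e \<in> E. sign (\<sigma> e)) * (-2) ^ num_curves E R \<gamma> \<sigma>)"

text \<open>Vertex normalisation, computed from any half-edge of the vertex (it is
  symmetric in a, b, c).\<close>
definition vertex_factor :: "('e \<times> bool \<Rightarrow> 'e \<times> bool) \<Rightarrow> ('e \<Rightarrow> nat) \<Rightarrow> 'e \<times> bool \<Rightarrow> real" where
  "vertex_factor R \<gamma> h =
     (let a = \<gamma> (fst h); b = \<gamma> (fst (R h)); c = \<gamma> (fst (R (R h))) in
       real (fact ((a + b + c) div 2 + 1) * fact ((a + b - c) div 2)
             * fact ((a + c - b) div 2) * fact ((b + c - a) div 2)))"

definition unitary_eval :: "'e set \<Rightarrow> ('e \<times> bool \<Rightarrow> 'e \<times> bool) \<Rightarrow> ('e \<Rightarrow> nat) \<Rightarrow> real" where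
  "unitary_eval E R \<gamma> =
     real_of_int (penrose_eval E R \<gamma>) *
       (\<Prod>v \<in> vertices E R. vertex_factor R \<gamma> (SOME h. h \<in> v) powr (-1/2))"

end

theory Submission
  imports Defs
begin

text \<open>
  The binor identity turns the signed loop count into a sum over two-valued spins.  A strand diagram
  is a union of two perfect matchings of the strand ends (arcs at vertices, strands along edges).
  It has \<open>2 ^ N\<close> spin assignments that flip along every arc and every strand, and up to a local
  factor \<open>(-1) ^ N\<close> is the sign of the inserted permutations.  Summing over the permutations on
  the edges leaves, for each assignment of a number \<open>k e \<le> \<gamma> e\<close> of up spins to the edges, the
  product of \<open>k e! (\<gamma> e - k e)!\<close> over the edges times a product of vertex sums, which are the
  unnormalised Clebsch--Gordan coefficients of SU(2), that is, the coefficients of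
  \<open>(s - t) ^ z (t - w) ^ x (w - s) ^ y\<close>.  Distributing the edge factors evenly to the two ends,
  every vertex contributes an entry of a tensor whose norm is, by Cayley's identity for the
  operator adjoint to multiplication by \<open>s - t\<close>, exactly the unitary normalisation.  Every
  term is therefore at most \<open>1\<close> after normalisation, and there are \<open>\<Prod>e. \<gamma> e + 1\<close> terms.
\<close>

text \<open>The defining sum has \<open>\<Prod>e. fact (\<gamma> e)\<close> signed terms, of size
  exponential in the number of strands, so estimates term by term are hopeless and the cancellation
  has to be found. The obstacle is that the number of closed curves is global. Its parity becomes
  local because a bijection carrying the arc matching to the strand matching has a sign that can be
  read off from any common transversal; inserting permutations multiplies this sign by theirs, and
  these then square to 1. For fixed spin counts on the edges, all remaining cancellation sits inside
  the vertex sums.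

  There it is computed and not estimated. The weights \<open>fact k * fact (m - k)\<close> left by
  the edges are, up to scale, those of the SU(2)-invariant inner product on binary forms of degree
  \<open>m\<close>. In it the adjoint of multiplication by \<open>s - t\<close> is Cayley's Omega
  operator, and the vertex polynomial is an eigenvector of the multiplication followed by its
  adjoint. Bounding one entry by the whole norm is affordable because only polynomially many choices
  of spin counts remain; this is where the exponent, the number of edges, comes from.\<close>

section \<open>Vertex sums\<close>

text \<open>The third exponent of the coefficient is \<open>x + y + z - i - j\<close> and is suppressed; signs are
  normalised so that the recursion is multiplication by \<open>t - s\<close>.\<close>

fun cg :: "nat \<Rightarrow> nat \<Rightarrow> nat \<Rightarrow> nat \<Rightarrow> nat \<Rightarrow> real" where
  "cg x y 0 i j = (-1) ^ (i + j) * real (x choose j) * real (y choose i)"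
| "cg x y (Suc z) i j = (if j = 0 then 0 else cg x y z i (j - 1)) - (if i = 0 then 0 else cg x y z (i - 1) j)"

section \<open>Cayley's identity and the norm of the vertex coefficients\<close>

lemma cg_eq_0: "i > y + z \<or> j > x + z \<Longrightarrow> cg x y z i j = 0"
proof (induction z arbitrary: i j)
  case (Suc z)
  then have "j = 0 \<or> cg x y z i (j - 1) = 0" "i = 0 \<or> cg x y z (i - 1) j = 0"
    by (auto intro!: Suc.IH)
  then show ?case by auto
qed auto

text \<open>The action on coefficients of the second-order operator that is, up to sign, adjoint to
  multiplication by \<open>t - s\<close> in the inner product with weight \<open>cg_weight\<close>.\<close>

definition cayley :: "nat \<Rightarrow> nat \<Rightarrow> nat \<Rightarrow> nat \<Rightarrow> nat \<Rightarrow> real" where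
  "cayley x y z i j = (real i + 1) * (real (x + z) - real j) * cg x y z (Suc i) j
     - (real (y + z) - real i) * (real j + 1) * cg x y z i (Suc j)"

lemma choose_Suc_mult: "(real i + 1) * real (y choose Suc i) = (real y - real i) * real (y choose i)"
proof (cases "i \<le> y")
  case True
  have "Suc i * (y choose Suc i) = (y - i) * (y choose i)"
    using binomial_absorb_comp[of y i] binomial_absorption[of i y] by simp
  then have "real (Suc i * (y choose Suc i)) = real ((y - i) * (y choose i))" by presburger
  then have "real (Suc i) * real (y choose Suc i) = real (y - i) * real (y choose i)"
    by (simp only: of_nat_mult)
  with True show ?thesis by (simp add: of_nat_diff add.commute)
qed (simp add: binomial_eq_0)

text \<open>In homogeneous coordinates the operator is the determinant of the gradients in
  \<open>s\<close> and \<open>t\<close>. For \<open>(t - w)^x (w - s)^y\<close> both gradients are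
  multiples of one vector, determined by \<open>w\<close>, so the determinant vanishes.\<close>

lemma cayley_0: "cayley x y 0 i j = 0"
proof -
  have "cayley x y 0 i j = (-1) ^ (i + j) *
    (((real y - real i) * real (y choose i)) * ((real j + 1) * real (x choose Suc j))
     - ((real i + 1) * real (y choose Suc i)) * ((real x - real j) * real (x choose j)))"
    by (simp add: cayley_def algebra_simps)
  then show ?thesis by (simp only: choose_Suc_mult) simp
qed

text \<open>Commuting the operator past one factor \<open>t - s\<close> costs the multiple
  \<open>x + y + 2 * z + 2\<close>, the sum of the two degrees plus 2. Since the operator kills the
  case without such factors, the costs add up to \<open>(z + 1) * (x + y + z + 2)\<close>.\<close>

lemma cayley_Suc: "cayley x y (Suc z) i j = - (real (Suc z) * (real (x + y + z) + 2)) * cg x y z i j"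
proof (induction z arbitrary: i j)
  have step: "cayley x y (Suc z) i j = (if j = 0 then 0 else cayley x y z i (j - 1))
     - (if i = 0 then 0 else cayley x y z (i - 1) j) - (real (x + y + 2 * z) + 2) * cg x y z i j" for z i j
    by (cases i; cases j) (simp_all add: cayley_def algebra_simps)
  { case 0 show ?case by (subst step) (simp add: cayley_0 algebra_simps) }
  { case (Suc z)
    show ?case
      by (subst step) (cases i; cases j; simp add: Suc algebra_simps) }
qed

text \<open>The SU(2)-invariant inner product, up to scale, for forms of degrees
  \<open>y + z\<close>, \<open>x + z\<close> and \<open>x + y\<close>: the monomial with exponent
  \<open>i\<close> in degree \<open>m\<close> has weight \<open>fact i * fact (m - i)\<close>. The
  third exponent is \<open>x + y + z - (i + j)\<close>; \<open>cg\<close> vanishes wherever a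
  subtraction involving it would truncate.\<close>

definition cg_weight :: "nat \<Rightarrow> nat \<Rightarrow> nat \<Rightarrow> nat \<Rightarrow> nat \<Rightarrow> real" where
  "cg_weight x y z i j = fact i * fact (y + z - i) * fact j * fact (x + z - j) *
     (fact (x + y + z - (i + j)) * fact (x + y - (x + y + z - (i + j))))"

definition cg_norm :: "nat \<Rightarrow> nat \<Rightarrow> nat \<Rightarrow> real" where
  "cg_norm x y z = (\<Sum>i\<le>y + z. \<Sum>j\<le>x + z. (cg x y z i j)\<^sup>2 * cg_weight x y z i j)"

text \<open>With \<open>F' = (t - s) F\<close>, one factor \<open>t - s\<close> in the inner product
  of \<open>F'\<close> with itself is moved to the other side. This leaves the inner product of
  \<open>F\<close> with the adjoint applied to \<open>F'\<close>, a multiple of \<open>F\<close> by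
  \<open>cayley_Suc\<close>.\<close>

lemma cg_norm_Suc: "cg_norm x y (Suc z) = real (Suc z) * (real (x + y + z) + 2) * cg_norm x y z"
proof -
  let ?a = "y + z" and ?b = "x + z"
  define F where "F = cg x y z"
  define F' where "F' = cg x y (Suc z)"
  define w where "w = cg_weight x y z"
  define w' where "w' = cg_weight x y (Suc z)"
  \<comment> \<open>The ratio of consecutive weights supplies the coefficients of the adjoint
    operator. The third exponent is unchanged by the shift.\<close>
  have w1: "w' i (Suc j) = (real ?a + 1 - real i) * (real j + 1) * w i j" if "i \<le> ?a" for i j
    using that by (simp add: w_def w'_def cg_weight_def Suc_diff_le algebra_simps)
  have w2: "w' (Suc i) j = (real i + 1) * (real ?b + 1 - real j) * w i j" if "j \<le> ?b" for i j
    using that by (simp add: w_def w'_def cg_weight_def Suc_diff_le algebra_simps)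
  \<comment> \<open>\<open>F\<close> vanishes just outside its range, so the shifted sums both
    reduce to the same rectangle.\<close>
  have zero: "F (Suc ?a) j = 0" "F i (Suc ?b) = 0" for i j
    by (simp_all add: F_def cg_eq_0)
  have "cg_norm x y (Suc z) = (\<Sum>i\<le>Suc ?a. \<Sum>j\<le>Suc ?b. F' i j * w' i j *
      ((if j = 0 then 0 else F i (j - 1)) - (if i = 0 then 0 else F (i - 1) j)))"
    unfolding cg_norm_def F_def F'_def w'_def power2_eq_square
    by (simp add: mult_ac del: sum.atMost_Suc)
  also have "\<dots> = (\<Sum>i\<le>Suc ?a. \<Sum>j\<le>Suc ?b. F' i j * w' i j * (if j = 0 then 0 else F i (j - 1)))
      - (\<Sum>i\<le>Suc ?a. \<Sum>j\<le>Suc ?b. F' i j * w' i j * (if i = 0 then 0 else F (i - 1) j))"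
    by (simp only: right_diff_distrib sum_subtractf)
  also have "(\<Sum>i\<le>Suc ?a. \<Sum>j\<le>Suc ?b. F' i j * w' i j * (if j = 0 then 0 else F i (j - 1)))
      = (\<Sum>i\<le>?a. \<Sum>j\<le>?b. F' i (Suc j) * w' i (Suc j) * F i j)"
    by (subst sum.atMost_Suc_shift[where n = ?b]) (simp add: zero)
  also have "\<dots> = (\<Sum>i\<le>?a. \<Sum>j\<le>?b. F i j * w i j * ((real ?a + 1 - real i) * (real j + 1) * F' i (Suc j)))"
    by (intro sum.cong refl, subst w1) auto
  also have "(\<Sum>i\<le>Suc ?a. \<Sum>j\<le>Suc ?b. F' i j * w' i j * (if i = 0 then 0 else F (i - 1) j))
      = (\<Sum>i\<le>?a. \<Sum>j\<le>?b. F' (Suc i) j * w' (Suc i) j * F i j)"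
    by (subst sum.atMost_Suc_shift[where n = ?a]) (simp add: zero)
  also have "\<dots> = (\<Sum>i\<le>?a. \<Sum>j\<le>?b. F i j * w i j * ((real i + 1) * (real ?b + 1 - real j) * F' (Suc i) j))"
    by (intro sum.cong refl, subst w2) auto
  also have "(\<Sum>i\<le>?a. \<Sum>j\<le>?b. F i j * w i j * ((real ?a + 1 - real i) * (real j + 1) * F' i (Suc j))) - \<dots>
      = (\<Sum>i\<le>?a. \<Sum>j\<le>?b. F i j * w i j * (- cayley x y (Suc z) i j))"
    by (simp add: sum_subtractf [symmetric] cayley_def F'_def algebra_simps)
  also have "\<dots> = (\<Sum>i\<le>?a. \<Sum>j\<le>?b. real (Suc z) * (real (x + y + z) + 2) * (F i j ^ 2 * w i j))"
    by (intro sum.cong refl) (simp only: cayley_Suc F_def power2_eq_square mult_minus_left mult_minus_right minus_minus mult_ac)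
  also have "\<dots> = real (Suc z) * (real (x + y + z) + 2) * cg_norm x y z"
    by (simp only: cg_norm_def F_def w_def sum_distrib_left)
  finally show ?thesis .
qed

text \<open>On the diagonal \<open>i + j = s\<close> Vandermonde's identity collapses the sum to
  \<open>(x + y choose s) * fact s * fact (x + y - s)\<close>, which is \<open>fact (x + y)\<close>;
  there are \<open>x + y + 1\<close> diagonals.\<close>

lemma cg_norm_0: "cg_norm x y 0 = fact x * fact y * fact (x + y + 1)"
proof -
  have ch: "fact n = real (n choose k) * (fact k * fact (n - k))" if "k \<le> n" for n k
    using binomial_fact_lemma[OF that] by (metis (mono_tags) of_nat_fact of_nat_mult mult.commute)
  let ?g = "\<lambda>i j. real (y choose i) * real (x choose j) * (fact (i + j) * fact (x + y - (i + j)))"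
  have summand: "(cg x y 0 i j)\<^sup>2 * cg_weight x y 0 i j = fact x * fact y * ?g i j"
    if "i \<le> y" "j \<le> x" for i j
  proof -
    from that have "x + y - (x + y - (i + j)) = i + j" by simp
    with that show ?thesis
      by (simp add: cg_weight_def power_mult_distrib ch[of j x] ch[of i y] power2_eq_square
          flip: power_add mult_2)
  qed
  have "cg_norm x y 0 = (\<Sum>i\<le>y. \<Sum>j\<le>x. fact x * fact y * ?g i j)"
    by (simp add: cg_norm_def summand del: cg.simps)
  also have "\<dots> = fact x * fact y * (\<Sum>i\<le>y. \<Sum>j\<le>x. ?g i j)"
    by (simp only: sum_distrib_left)
  also have "(\<Sum>i\<le>y. \<Sum>j\<le>x. ?g i j) = (\<Sum>(i, j)\<in>{..y} \<times> {..x}. ?g i j)"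
    by (simp add: sum.cartesian_product)
  \<comment> \<open>Enlarging the rectangle to the triangle adds only terms with a vanishing
    binomial coefficient.\<close>
  also have "\<dots> = (\<Sum>(i, j)\<in>{(i, j). i + j \<le> x + y}. ?g i j)"
  proof (rule sum.mono_neutral_left)
    show "finite {(i, j). i + j \<le> x + y}"
      by (rule finite_subset[of _ "{..x+y} \<times> {..x+y}"]) auto
  qed (auto simp: not_le)
  also have "\<dots> = (\<Sum>s\<le>x + y. \<Sum>i\<le>s. ?g i (s - i))"
    by (rule sum.triangle_reindex_eq)
  also have "\<dots> = (\<Sum>s\<le>x + y. fact (x + y))"
  proof (rule sum.cong, goal_cases)
    case (2 s)
    have "(\<Sum>i\<le>s. ?g i (s - i)) = (\<Sum>i\<le>s. real ((y choose i) * (x choose (s - i)))) * (fact s * fact (x + y - s))"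
      by (simp add: sum_distrib_right)
    also have "\<dots> = real ((y + x) choose s) * (fact s * fact (x + y - s))"
      by (simp only: vandermonde flip: of_nat_sum)
    also have "\<dots> = fact (x + y)" using 2 ch[of s "x + y"] by (simp add: add.commute)
    finally show ?case .
  qed auto
  also have "\<dots> = fact (x + y + 1)" by simp
  finally show ?thesis .
qed

lemma cg_norm: "cg_norm x y z = fact x * fact y * fact z * fact (x + y + z + 1)"
  by (induction z) (simp_all add: cg_norm_0 cg_norm_Suc algebra_simps)

lemma cg_bound:
  assumes "i \<le> y + z" "j \<le> x + z" "k \<le> x + y" "i + j + k = x + y + z"
  shows "(cg x y z i j)\<^sup>2 * (fact i * fact (y + z - i) * (fact j * fact (x + z - j)) * (fact k * fact (x + y - k)))
    \<le> fact x * fact y * fact z * fact (x + y + z + 1)"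
proof -
  have nonneg: "0 \<le> (cg x y z i j)\<^sup>2 * cg_weight x y z i j" for i j
    by (simp add: cg_weight_def)
  have "k = x + y + z - (i + j)" using assms by simp
  then have "(cg x y z i j)\<^sup>2 * (fact i * fact (y + z - i) * (fact j * fact (x + z - j)) * (fact k * fact (x + y - k)))
      = (cg x y z i j)\<^sup>2 * cg_weight x y z i j"
    by (simp add: cg_weight_def)
  also have "\<dots> \<le> (\<Sum>j\<le>x + z. (cg x y z i j)\<^sup>2 * cg_weight x y z i j)"
    by (rule member_le_sum) (use assms nonneg in auto)
  also have "\<dots> \<le> cg_norm x y z"
    unfolding cg_norm_def
    by (rule member_le_sum[where f = "\<lambda>i. \<Sum>j\<le>x + z. (cg x y z i j)\<^sup>2 * cg_weight x y z i j"])
       (use assms nonneg in \<open>auto intro: sum_nonneg\<close>)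
  finally show ?thesis by (simp add: cg_norm)
qed


section \<open>State-sum form of the vertex coefficients\<close>

lemma alternating_binomial_sum_Suc:
  fixes g :: "nat \<Rightarrow> nat \<Rightarrow> real"
  shows "(\<Sum>p\<le>Suc z. (-1) ^ p * real (Suc z choose p) * g p (Suc z - p)) =
    (\<Sum>p\<le>z. (-1) ^ p * real (z choose p) * g p (Suc (z - p)))
    - (\<Sum>p\<le>z. (-1) ^ p * real (z choose p) * g (Suc p) (z - p))"
proof -
  \<comment> \<open>Pascal's rule splits every coefficient except the one at \<open>p = 0\<close>;
    the isolated term \<open>g 0 (Suc z)\<close> is reabsorbed afterwards.\<close>
  have "(\<Sum>p\<le>Suc z. (-1) ^ p * real (Suc z choose p) * g p (Suc z - p)) =
    g 0 (Suc z) - (\<Sum>p\<le>z. (-1) ^ p * real (z choose Suc p) * g (Suc p) (z - p))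
    - (\<Sum>p\<le>z. (-1) ^ p * real (z choose p) * g (Suc p) (z - p))"
  proof -
    have "(\<Sum>p\<le>z. (-1) ^ Suc p * real (Suc z choose Suc p) * g (Suc p) (Suc z - Suc p))
      = (\<Sum>p\<le>z. - ((-1) ^ p * real (z choose Suc p) * g (Suc p) (z - p))
            - (-1) ^ p * real (z choose p) * g (Suc p) (z - p))"
      by (intro sum.cong refl) (simp add: algebra_simps)
    then show ?thesis by (subst sum.atMost_Suc_shift) (simp add: sum_negf sum_subtractf)
  qed
  also have "g 0 (Suc z) - (\<Sum>p\<le>z. (-1) ^ p * real (z choose Suc p) * g (Suc p) (z - p))
    = (\<Sum>p\<le>Suc z. (-1) ^ p * real (z choose p) * g p (Suc z - p))"
    by (subst sum.atMost_Suc_shift) (simp add: sum_negf)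
  also have "\<dots> = (\<Sum>p\<le>z. (-1) ^ p * real (z choose p) * g p (Suc (z - p)))"
    by (simp add: Suc_diff_le)
  finally show ?thesis .
qed

text \<open>Expands \<open>(t - s)^z\<close>: \<open>p\<close> factors contribute \<open>s\<close>
  and \<open>z - p\<close> contribute \<open>t\<close>. The guard keeps the truncated subtractions
  from reading a coefficient at a wrong index.\<close>

lemma cg_eq_sum:
  "cg x y z i j = (\<Sum>p\<le>z. (-1) ^ p * real (z choose p) *
     (if p \<le> i \<and> z - p \<le> j then cg x y 0 (i - p) (j - (z - p)) else 0))"
proof (induction z arbitrary: i j)
  case (Suc z)
  define h where "h = (\<lambda>i j p m. if p \<le> i \<and> m \<le> j then cg x y 0 (i - p) (j - m) else 0)"
  have IH: "cg x y z i j = (\<Sum>p\<le>z. (-1) ^ p * real (z choose p) * h i j p (z - p))" for i j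
    unfolding h_def by (rule Suc)
  have h1: "h i j p (Suc m) = (if j = 0 then 0 else h i (j - 1) p m)" for p m
    by (auto simp: h_def simp del: cg.simps)
  have h2: "h i j (Suc p) m = (if i = 0 then 0 else h (i - 1) j p m)" for p m
    by (auto simp: h_def simp del: cg.simps)
  have "cg x y (Suc z) i j = (\<Sum>p\<le>Suc z. (-1) ^ p * real (Suc z choose p) * h i j p (Suc z - p))"
    unfolding alternating_binomial_sum_Suc h1 h2 by (simp add: IH)
  then show ?case unfolding h_def .
qed simp

text \<open>The three bundles of arcs at a vertex have \<open>z\<close>, \<open>x\<close> and
  \<open>y\<close> members. In them \<open>p\<close>, \<open>q\<close> and \<open>r\<close> arcs are
  up at their first end, hence \<open>z - p\<close>, \<open>x - q\<close> and \<open>y - r\<close>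
  are up at the other; \<open>i\<close>, \<open>j\<close>, \<open>k\<close> prescribe the resulting
  counts on the three half-edges.\<close>

definition vertex_sum :: "nat \<Rightarrow> nat \<Rightarrow> nat \<Rightarrow> nat \<Rightarrow> nat \<Rightarrow> nat \<Rightarrow> real" where
  "vertex_sum x y z i j k = (\<Sum>p\<le>z. \<Sum>q\<le>x. \<Sum>r\<le>y.
     real (z choose p) * real (x choose q) * real (y choose r) *
     (if p + (y - r) = i \<and> q + (z - p) = j \<and> r + (x - q) = k then (-1) ^ (p + q + r) else 0))"

lemma sum_if_inj_eq:
  fixes f :: "nat \<Rightarrow> real"
  assumes "\<And>r. r \<in> A \<Longrightarrow> P r \<longleftrightarrow> Q \<and> r = s" "finite A"
  shows "(\<Sum>r\<in>A. if P r then f r else 0) = (if Q \<and> s \<in> A then f s else 0)"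
proof -
  have "(\<Sum>r\<in>A. if P r then f r else 0) = (\<Sum>r\<in>A. if s = r then (if Q then f r else 0) else 0)"
    by (intro sum.cong) (auto simp: assms)
  also have "\<dots> = (if Q \<and> s \<in> A then f s else 0)" using assms(2) by (subst sum.delta') auto
  finally show ?thesis .
qed

text \<open>Each arc is up at exactly one end, so the counts must add up to the number of arcs. When
  they do, \<open>p\<close> determines \<open>q\<close> and \<open>r\<close>, and replacing
  \<open>r\<close> by \<open>y - r\<close> gives the sum of \<open>cg_eq_sum\<close> at the price of
  the sign \<open>(-1) ^ y\<close>.\<close>

lemma abs_vertex_sum:
  "\<bar>vertex_sum x y z i j k\<bar> = (if i + j + k = x + y + z then \<bar>cg x y z i j\<bar> else 0)"
proof (cases "i + j + k = x + y + z")
  case False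
  then have "vertex_sum x y z i j k = 0"
    unfolding vertex_sum_def by (intro sum.neutral ballI) auto
  with False show ?thesis by simp
next
  case True
  have inner: "(\<Sum>q\<le>x. \<Sum>r\<le>y. real (z choose p) * real (x choose q) * real (y choose r) *
     (if p + (y - r) = i \<and> q + (z - p) = j \<and> r + (x - q) = k then (-1) ^ (p + q + r) else 0))
    = (-1) ^ y * ((-1) ^ p * real (z choose p) *
     (if p \<le> i \<and> z - p \<le> j then cg x y 0 (i - p) (j - (z - p)) else 0))" if "p \<le> z" for p
  proof -
    let ?m = "z - p"
    have sgn: "(-1::real) ^ (y - (i - p)) = (-1) ^ y * (-1) ^ (i - p)" if "i - p \<le> y"
      using neg_one_power_add_eq_neg_one_power_diff[OF that, where ?'a = real] by (simp add: power_add)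
    have sym: "y choose (y - (i - p)) = y choose (i - p)" if "i - p \<le> y"
      using binomial_symmetric[OF that] by simp
    have "(\<Sum>q\<le>x. \<Sum>r\<le>y. real (z choose p) * real (x choose q) * real (y choose r) *
        (if p + (y - r) = i \<and> q + ?m = j \<and> r + (x - q) = k then (-1) ^ (p + q + r) else 0))
      = (\<Sum>q\<le>x. \<Sum>r\<le>y. (-1) ^ p * real (z choose p) *
         ((if q + ?m = j then (-1) ^ q * real (x choose q) else 0) *
          (if p + (y - r) = i then (-1) ^ r * real (y choose r) else 0)))"
      using True that by (intro sum.cong refl) (auto simp: power_add)
    also have "\<dots> = (-1) ^ p * real (z choose p) *
         ((\<Sum>q\<le>x. if q + ?m = j then (-1) ^ q * real (x choose q) else 0) *
          (\<Sum>r\<le>y. if p + (y - r) = i then (-1) ^ r * real (y choose r) else 0))"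
      by (subst sum_product) (simp only: sum_distrib_left)
    also have "(\<Sum>q\<le>x. if q + ?m = j then (-1) ^ q * real (x choose q) else 0)
       = (if ?m \<le> j \<and> j - ?m \<in> {..x} then (-1) ^ (j - ?m) * real (x choose (j - ?m)) else 0)"
      by (rule sum_if_inj_eq) auto
    also have "(\<Sum>r\<le>y. if p + (y - r) = i then (-1) ^ r * real (y choose r) else 0)
       = (if (p \<le> i \<and> i - p \<le> y) \<and> y - (i - p) \<in> {..y} then (-1) ^ (y - (i - p)) * real (y choose (y - (i - p))) else 0)"
      by (rule sum_if_inj_eq) auto
    finally have eq: "(\<Sum>q\<le>x. \<Sum>r\<le>y. real (z choose p) * real (x choose q) * real (y choose r) *
        (if p + (y - r) = i \<and> q + ?m = j \<and> r + (x - q) = k then (-1) ^ (p + q + r) else 0))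
      = (-1) ^ p * real (z choose p) *
        ((if ?m \<le> j \<and> j - ?m \<in> {..x} then (-1) ^ (j - ?m) * real (x choose (j - ?m)) else 0) *
         (if (p \<le> i \<and> i - p \<le> y) \<and> y - (i - p) \<in> {..y}
          then (-1) ^ (y - (i - p)) * real (y choose (y - (i - p))) else 0))" .
    define u v where "u = i - p" and "v = j - ?m"
    have "(if p \<le> i \<and> u \<le> y then (-1) ^ (y - u) * real (y choose (y - u)) else 0)
        = (if p \<le> i then (-1) ^ y * ((-1) ^ u * real (y choose u)) else 0)"
      using sgn sym by (auto simp: u_def [symmetric] binomial_eq_0)
    moreover have "(if ?m \<le> j \<and> v \<in> {..x} then (-1) ^ v * real (x choose v) else 0)
        = (if ?m \<le> j then (-1) ^ v * real (x choose v) else 0)"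
      by (auto simp: binomial_eq_0)
    ultimately show ?thesis
      unfolding eq u_def [symmetric] v_def [symmetric] by (auto simp add: power_add)
  qed
  have "vertex_sum x y z i j k = (-1) ^ y * cg x y z i j"
    unfolding vertex_sum_def
    by (subst cg_eq_sum, subst sum_distrib_left, rule sum.cong[OF refl], rule inner) simp
  with True show ?thesis by (simp add: abs_mult power_abs)
qed

lemma vertex_sum_bound:
  assumes "i \<le> y + z" "j \<le> x + z" "k \<le> x + y"
  shows "\<bar>vertex_sum x y z i j k\<bar> * sqrt (fact i * fact (y + z - i)) * sqrt (fact j * fact (x + z - j))
      * sqrt (fact k * fact (x + y - k))
    \<le> sqrt (fact (x + y + z + 1) * fact x * fact y * fact z)"
proof (cases "i + j + k = x + y + z")
  case True
  show ?thesis
  proof (rule real_le_rsqrt, goal_cases)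
    case 1
    show ?case using cg_bound[OF assms True] True
      by (simp add: abs_vertex_sum power_mult_distrib mult_ac)
  qed
qed (simp add: abs_vertex_sum)

section \<open>Pairs of perfect matchings\<close>

text \<open>The exponent \<open>m\<close> is the number of cycles, since invariant sets are unions
  of cycles; counting through invariant sets allows a direct comparison with closed sets of strand
  ends later. The induction cuts \<open>x\<close> out of its cycle by composing with a
  transposition: if \<open>x\<close> is fixed a cycle disappears, otherwise the sign changes and the
  cycle count stays.\<close>

lemma sign_eq_invariant_sets:
  assumes "finite S" "p permutes S"
  shows "\<exists>m. card {T. T \<subseteq> S \<and> p ` T \<subseteq> T} = 2 ^ m \<and> sign p = (-1) ^ (card S + m)"
  using assms
proof (induction S arbitrary: p rule: finite_induct)
  case empty
  then have "p = id" by simp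
  then show ?case by (intro exI[of _ 0]) auto
next
  case (insert x S)
  define q where "q = transpose x (p x) \<circ> p"
  have q: "q permutes S" unfolding q_def by (rule permutes_insert_lemma[OF insert.prems])
  obtain m where m: "card {T. T \<subseteq> S \<and> q ` T \<subseteq> T} = 2 ^ m" "sign q = (-1) ^ (card S + m)"
    using insert.IH[OF q] by blast
  have inj: "p a = p b \<longleftrightarrow> a = b" for a b
    using permutes_inj[OF insert.prems] by (auto dest: injD)
  show ?case
  proof (cases "p x = x")
    case True
    then have "q = p" by (simp add: q_def)
    with q have p: "p permutes S" by simp
    let ?I = "{T. T \<subseteq> S \<and> p ` T \<subseteq> T}"
    have "{T. T \<subseteq> insert x S \<and> p ` T \<subseteq> T} = ?I \<union> insert x ` ?I"
    proof (intro subset_antisym subsetI)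
      fix T assume T: "T \<in> {T. T \<subseteq> insert x S \<and> p ` T \<subseteq> T}"
      have "T - {x} \<in> ?I"
        using T True inj by (auto simp: image_subset_iff)
      moreover have "T = T - {x} \<or> T = insert x (T - {x})" by blast
      ultimately show "T \<in> ?I \<union> insert x ` ?I" by blast
    qed (use True in auto)
    moreover have "card (?I \<union> insert x ` ?I) = card ?I + card (insert x ` ?I)"
      using insert.hyps by (intro card_Un_disjoint) (auto intro: finite_subset[of _ "Pow S"])
    moreover have "card (insert x ` ?I) = card ?I"
      using insert.hyps by (intro card_image) (auto simp: inj_on_def)
    ultimately show ?thesis
      using m insert.hyps \<open>q = p\<close> by (intro exI[of _ "Suc m"]) simp
  next
    case False
    have perm: "permutation p"
      using insert.prems insert.hyps by (auto simp: permutation_permutes)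
    have "sign q = sign (transpose x (p x)) * sign p"
      unfolding q_def by (rule sign_compose[OF permutation_swap_id perm])
    with False have sq: "sign q = - sign p" by (simp add: sign_swap_id)
    have qval: "q y = (if p y = x then p x else p y)" if "y \<in> S" for y
      using that insert.hyps inj by (auto simp: q_def transpose_def)
    \<comment> \<open>An injective self-map of a finite set is onto, so invariance also runs
      backwards. Hence membership of \<open>x\<close> can be recovered from that of
      \<open>p x\<close>.\<close>
    have pT: "x \<in> T \<longleftrightarrow> p x \<in> T" if "T \<subseteq> insert x S" "p ` T \<subseteq> T" for T
    proof -
      have "finite T" using that insert.hyps finite_subset by blast
      then have "p ` T = T"
        using that(2) inj by (intro endo_inj_surj) (auto simp: inj_on_def)
      moreover have "p x \<in> p ` T \<longleftrightarrow> x \<in> T" using inj by auto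
      ultimately show ?thesis by simp
    qed
    have "card {T. T \<subseteq> insert x S \<and> p ` T \<subseteq> T} = card {T. T \<subseteq> S \<and> q ` T \<subseteq> T}"
    proof (rule bij_betw_same_card, rule bij_betw_byWitness[where f = "\<lambda>T. T - {x}"
          and f' = "\<lambda>U. if p x \<in> U then insert x U else U"])
      show "\<forall>T\<in>{T. T \<subseteq> insert x S \<and> p ` T \<subseteq> T}.
          (if p x \<in> T - {x} then insert x (T - {x}) else T - {x}) = T"
      proof (rule ballI, goal_cases)
        case (1 T)
        with pT[of T] False show ?case by auto
      qed
      show "\<forall>U\<in>{T. T \<subseteq> S \<and> q ` T \<subseteq> T}. (if p x \<in> U then insert x U else U) - {x} = U"
        using insert.hyps by auto
      show "(\<lambda>T. T - {x}) ` {T. T \<subseteq> insert x S \<and> p ` T \<subseteq> T} \<subseteq> {T. T \<subseteq> S \<and> q ` T \<subseteq> T}"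
      proof (rule image_subsetI)
        fix T assume "T \<in> {T. T \<subseteq> insert x S \<and> p ` T \<subseteq> T}"
        then have T: "T \<subseteq> insert x S" "p ` T \<subseteq> T" by auto
        have "q y \<in> T - {x}" if "y \<in> T - {x}" for y
        proof -
          have "y \<in> S" "p y \<in> T" using that T by auto
          then show ?thesis using qval[of y] False pT[OF T] by auto
        qed
        then show "T - {x} \<in> {T. T \<subseteq> S \<and> q ` T \<subseteq> T}" using T by auto
      qed
      show "(\<lambda>U. if p x \<in> U then insert x U else U) ` {T. T \<subseteq> S \<and> q ` T \<subseteq> T}
          \<subseteq> {T. T \<subseteq> insert x S \<and> p ` T \<subseteq> T}"
      proof (rule image_subsetI)
        fix U assume "U \<in> {T. T \<subseteq> S \<and> q ` T \<subseteq> T}"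
        then have U: "U \<subseteq> S" "q ` U \<subseteq> U" by auto
        have "p y = x \<and> p x \<in> U \<or> p y \<in> U" if "y \<in> U" for y
          using that U qval[of y] by (auto simp: subset_iff split: if_splits)
        then show "(if p x \<in> U then insert x U else U) \<in> {T. T \<subseteq> insert x S \<and> p ` T \<subseteq> T}"
          using U(1) insert.hyps by auto
      qed
    qed
    moreover have "sign p = - sign q" using sq by simp
    ultimately show ?thesis using m insert.hyps by (intro exI[of _ m]) simp
  qed
qed

lemma sign_on_Un:
  assumes "finite A" "finite B" "A \<inter> B = {}" "bij_betw f A A" "bij_betw f B B"
  shows "sign_on (A \<union> B) f = sign_on A f * sign_on B f"
proof -
  have "restrict_id f (A \<union> B) = restrict_id f A \<circ> restrict_id f B"
    using assms by (auto simp: restrict_id_def fun_eq_iff bij_betw_def)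
  then show ?thesis
    unfolding sign_on_def using assms
    by (simp add: sign_compose permutes_imp_permutation permutes_restrict_id)
qed

lemma sign_on_conj:
  assumes "finite A" "bij_betw f A A" "inj_on h A" "\<And>x. x \<in> A \<Longrightarrow> g (h x) = h (f x)"
  shows "sign_on (h ` A) g = sign_on A f"
proof -
  have "restrict_id g (h ` A) = map_permutation A h (restrict_id f A)"
    using assms by (auto simp: map_permutation_def restrict_id_def fun_eq_iff bij_betw_def)
  then show ?thesis
    unfolding sign_on_def using assms by (simp add: sign_map_permutation permutes_restrict_id)
qed

text \<open>Closed sets are the unions of classes, and a family of classes can be recovered from its
  union because classes are nonempty and disjoint.\<close>

lemma card_closed_sets:
  assumes "finite X" "K \<subseteq> X \<times> X" "sym K"
  shows "card {T. T \<subseteq> X \<and> K `` T \<subseteq> T} = 2 ^ card (X // K\<^sup>*)"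
proof -
  have sym: "sym (K\<^sup>*)" using assms(3) by (rule sym_rtrancl)
  have sub: "K\<^sup>* `` {x} \<subseteq> X" if "x \<in> X" for x
  proof
    fix y assume "y \<in> K\<^sup>* `` {x}"
    then have "(x, y) \<in> K\<^sup>*" by simp
    then show "y \<in> X" by (induction) (use that assms(2) in auto)
  qed
  have closed: "K\<^sup>* `` T \<subseteq> T" if "K `` T \<subseteq> T" for T
  proof
    fix y assume "y \<in> K\<^sup>* `` T"
    then obtain x where "x \<in> T" "(x, y) \<in> K\<^sup>*" by auto
    from this(2,1) show "y \<in> T" by (induction) (use that in auto)
  qed
  have fin: "finite (X // K\<^sup>*)"
    by (rule finite_subset[of _ "Pow X"]) (use assms(1) sub in \<open>auto simp: quotient_def\<close>)
  have disj: "C = D" if CD: "C \<in> X // K\<^sup>*" "D \<in> X // K\<^sup>*" "z \<in> C" "z \<in> D" for C D z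
  proof -
    obtain x y where xy: "C = K\<^sup>* `` {x}" "D = K\<^sup>* `` {y}" using CD(1,2) by (meson quotientE)
    with CD have "(x, z) \<in> K\<^sup>*" "(y, z) \<in> K\<^sup>*" by auto
    then have "(x, y) \<in> K\<^sup>*" "(y, x) \<in> K\<^sup>*" using sym by (metis rtrancl_trans symD)+
    then show ?thesis unfolding xy by (auto intro: rtrancl_trans)
  qed
  have "bij_betw Union (Pow (X // K\<^sup>*)) {T. T \<subseteq> X \<and> K `` T \<subseteq> T}"
  proof (rule bij_betw_imageI)
    show "inj_on Union (Pow (X // K\<^sup>*))"
    proof (rule inj_onI, unfold Pow_iff)
      have mono: "\<A> \<subseteq> \<B>" if "\<A> \<subseteq> X // K\<^sup>*" "\<B> \<subseteq> X // K\<^sup>*" "\<Union>\<A> = \<Union>\<B>" for \<A> \<B>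
      proof
        fix C assume C: "C \<in> \<A>"
        then have "C \<in> X // K\<^sup>*" using that(1) by blast
        then obtain x where x: "x \<in> C" by (auto simp: quotient_def)
        with C that(3) obtain D where "D \<in> \<B>" "x \<in> D" by blast
        with disj[of C D x] C x that show "C \<in> \<B>" by auto
      qed
      fix \<A> \<B> assume "\<A> \<subseteq> X // K\<^sup>*" "\<B> \<subseteq> X // K\<^sup>*" "\<Union>\<A> = \<Union>\<B>"
      then show "\<A> = \<B>" using mono by (intro subset_antisym) auto
    qed
    show "Union ` Pow (X // K\<^sup>*) = {T. T \<subseteq> X \<and> K `` T \<subseteq> T}"
    proof (intro subset_antisym subsetI)
      fix T assume "T \<in> Union ` Pow (X // K\<^sup>*)"
      then obtain \<A> where A: "\<A> \<subseteq> X // K\<^sup>*" "T = \<Union>\<A>" by auto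
      have "T \<subseteq> X" using A sub by (auto simp: quotient_def)
      moreover have "K `` T \<subseteq> T"
        using A by (fastforce simp: quotient_def intro: rtrancl_into_rtrancl)
      ultimately show "T \<in> {T. T \<subseteq> X \<and> K `` T \<subseteq> T}" by simp
    next
      fix T assume "T \<in> {T. T \<subseteq> X \<and> K `` T \<subseteq> T}"
      then have T: "T \<subseteq> X" "K\<^sup>* `` T \<subseteq> T" using closed by auto
      have "T = \<Union>((\<lambda>x. K\<^sup>* `` {x}) ` T)" using T by auto
      moreover have "(\<lambda>x. K\<^sup>* `` {x}) ` T \<subseteq> X // K\<^sup>*" using T by (auto simp: quotient_def)
      ultimately show "T \<in> Union ` Pow (X // K\<^sup>*)" by blast
    qed
  qed
  then have "card {T. T \<subseteq> X \<and> K `` T \<subseteq> T} = card (Pow (X // K\<^sup>*))"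
    by (rule bij_betw_same_card[symmetric])
  then show ?thesis by (simp add: card_Pow fin)
qed

section \<open>Transversals common to two matchings\<close>

definition matching_on :: "'a set \<Rightarrow> ('a \<Rightarrow> 'a) \<Rightarrow> bool" where
  "matching_on X \<alpha> \<longleftrightarrow> (\<forall>x\<in>X. \<alpha> x \<in> X \<and> \<alpha> (\<alpha> x) = x \<and> \<alpha> x \<noteq> x)"

text \<open>A spin state: \<open>S\<close> is the set of up ends, and the spin flips along every
  pair of the matching.\<close>

definition transversal :: "'a set \<Rightarrow> ('a \<Rightarrow> 'a) \<Rightarrow> 'a set \<Rightarrow> bool" where
  "transversal X \<alpha> S \<longleftrightarrow> S \<subseteq> X \<and> (\<forall>x\<in>X. \<alpha> x \<in> S \<longleftrightarrow> x \<notin> S)"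

definition links :: "'a set \<Rightarrow> ('a \<Rightarrow> 'a) \<Rightarrow> ('a \<times> 'a) set" where
  "links X \<alpha> = {(x, \<alpha> x) | x. x \<in> X}"

lemma transversal_Diff: "matching_on X \<alpha> \<Longrightarrow> transversal X \<alpha> S \<Longrightarrow> transversal X \<alpha> (X - S)"
  by (auto simp: transversal_def matching_on_def)

lemma matching_on_bij: "matching_on X \<alpha> \<Longrightarrow> bij_betw \<alpha> X X"
  by (rule bij_betw_byWitness[where f' = \<alpha>]) (auto simp: matching_on_def)

lemma sym_links: "matching_on X \<alpha> \<Longrightarrow> sym (links X \<alpha>)"
  unfolding sym_def links_def matching_on_def by (auto; metis)

lemma transversal_image: "matching_on X \<alpha> \<Longrightarrow> transversal X \<alpha> S \<Longrightarrow> \<alpha> ` S = X - S"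
  unfolding transversal_def matching_on_def by (auto simp: image_iff subset_iff) metis

context
  fixes X :: "'a set" and \<alpha> \<beta> :: "'a \<Rightarrow> 'a"
  assumes fin: "finite X" and \<alpha>: "matching_on X \<alpha>" and \<beta>: "matching_on X \<beta>"
begin

private lemma \<alpha>D: "x \<in> X \<Longrightarrow> \<alpha> x \<in> X" "x \<in> X \<Longrightarrow> \<alpha> (\<alpha> x) = x" "x \<in> X \<Longrightarrow> \<alpha> x \<noteq> x"
  using \<alpha> by (auto simp: matching_on_def)

private lemma \<beta>D: "x \<in> X \<Longrightarrow> \<beta> x \<in> X" "x \<in> X \<Longrightarrow> \<beta> (\<beta> x) = x" "x \<in> X \<Longrightarrow> \<beta> x \<noteq> x"
  using \<beta> by (auto simp: matching_on_def)

private lemma pow_in: "x \<in> X \<Longrightarrow> ((\<beta> \<circ> \<alpha>) ^^ n) x \<in> X"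
  by (induction n) (auto simp: \<alpha>D \<beta>D)

text \<open>Two involutions generate a dihedral group, in which conjugation by \<alpha> inverts
  \<open>\<beta> \<circ> \<alpha>\<close>.\<close>

private lemma pow_reverse: "x \<in> X \<Longrightarrow> ((\<beta> \<circ> \<alpha>) ^^ n) (\<alpha> (((\<beta> \<circ> \<alpha>) ^^ n) x)) = \<alpha> x"
proof (induction n)
  case (Suc n)
  have "((\<beta> \<circ> \<alpha>) ^^ Suc n) (\<alpha> (((\<beta> \<circ> \<alpha>) ^^ Suc n) x))
      = ((\<beta> \<circ> \<alpha>) ^^ n) (\<beta> (\<alpha> (\<alpha> (\<beta> (\<alpha> (((\<beta> \<circ> \<alpha>) ^^ n) x))))))"
    by (subst funpow_Suc_right) simp
  also have "\<dots> = ((\<beta> \<circ> \<alpha>) ^^ n) (\<alpha> (((\<beta> \<circ> \<alpha>) ^^ n) x))"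
  proof -
    have "\<beta> (\<alpha> (\<alpha> (\<beta> (\<alpha> y)))) = \<alpha> y" if "y \<in> X" for y
      using that by (simp add: \<alpha>D \<beta>D)
    then show ?thesis using pow_in[OF Suc.prems] by (simp only:)
  qed
  also have "\<dots> = \<alpha> x" by (rule Suc.IH[OF Suc.prems])
  finally show ?case .
qed simp

text \<open>A walk that alternates between the two matchings cannot return to its start point through the
  partner: the middle of such a walk would be a fixed point of one of the matchings.\<close>

private lemma pow_neq: "x \<in> X \<Longrightarrow> ((\<beta> \<circ> \<alpha>) ^^ n) x \<noteq> \<alpha> x"
proof (induction n arbitrary: x rule: induct_nat_012)
  case 0 then show ?case using \<alpha>D(3)[of x] by simp
next
  case 1 then show ?case using \<alpha>D(1) \<beta>D(3)[of "\<alpha> x"] by simp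
next
  case (ge2 n)
  let ?y = "\<beta> (\<alpha> x)"
  have y: "?y \<in> X" by (simp add: ge2.prems \<alpha>D \<beta>D)
  show ?case
  proof
    assume "((\<beta> \<circ> \<alpha>) ^^ Suc (Suc n)) x = \<alpha> x"
    moreover have "((\<beta> \<circ> \<alpha>) ^^ Suc (Suc n)) x = \<beta> (\<alpha> (((\<beta> \<circ> \<alpha>) ^^ n) ?y))"
      by (simp only: funpow.simps(2)[of "Suc n"] funpow_Suc_right[of n] comp_apply)
    moreover obtain w where w: "w = ((\<beta> \<circ> \<alpha>) ^^ n) ?y" by blast
    ultimately have "\<beta> (\<alpha> w) = \<alpha> x" by (simp only:)
    then have "\<beta> (\<beta> (\<alpha> w)) = ?y" by (simp only:)
    moreover have "w \<in> X" unfolding w by (rule pow_in[OF y])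
    ultimately have "\<alpha> w = ?y" by (simp add: \<alpha>D \<beta>D)
    then have "w = \<alpha> ?y" using \<alpha>D(2)[OF \<open>w \<in> X\<close>] by simp
    with ge2.IH(1)[OF y] w show False by blast
  qed
qed

text \<open>Two perfect matchings together form even cycles, whose vertices can be 2-coloured. A
  colour class is obtained without naming the cycles, as a largest set that is closed under double
  steps and contains no pair of \<alpha>.\<close>

lemma ex_common_transversal: "\<exists>S. transversal X \<alpha> S \<and> transversal X \<beta> S"
proof -
  define F where "F = {S. S \<subseteq> X \<and> (\<forall>x\<in>S. \<alpha> x \<notin> S) \<and> (\<forall>x\<in>S. \<beta> (\<alpha> x) \<in> S)}"
  have "\<exists>S. S \<in> F \<and> (\<forall>T. T \<in> F \<longrightarrow> card T \<le> card S)"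
  proof (rule ex_has_greatest_nat)
    show "{} \<in> F" by (simp add: F_def)
    show "\<forall>T. T \<in> F \<longrightarrow> card T < Suc (card X)" using fin by (auto simp: F_def less_Suc_eq_le card_mono)
  qed
  then obtain S where "S \<in> F" and max: "\<And>T. T \<in> F \<Longrightarrow> card T \<le> card S" by blast
  then have S: "S \<subseteq> X" "\<And>x. x \<in> S \<Longrightarrow> \<alpha> x \<notin> S" "\<And>x. x \<in> S \<Longrightarrow> \<beta> (\<alpha> x) \<in> S"
    by (auto simp: F_def)
  have powS: "((\<beta> \<circ> \<alpha>) ^^ n) x \<in> S" if "x \<in> S" for n x
    by (induction n) (auto simp: that S)
  have cover: "\<alpha> x \<in> S" if x: "x \<in> X" "x \<notin> S" for x
  proof (rule ccontr)
    assume ax: "\<alpha> x \<notin> S"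
    \<comment> \<open>If a pair \<open>x\<close>, \<open>\<alpha> x\<close> is missed, the forward
      orbit of \<open>x\<close> under double steps can be added to \<open>S\<close>:
      \<open>pow_reverse\<close> keeps it away from partners of \<open>S\<close>, and
      \<open>pow_neq\<close> keeps it from containing a pair.\<close>
    define W where "W = range (\<lambda>n. ((\<beta> \<circ> \<alpha>) ^^ n) x)"
    have O1: "W \<subseteq> X" using pow_in[OF x(1)] by (auto simp: W_def)
    have O2: "\<beta> (\<alpha> y) \<in> W" if "y \<in> W" for y
    proof -
      from that obtain n where "y = ((\<beta> \<circ> \<alpha>) ^^ n) x" by (auto simp: W_def)
      then have "\<beta> (\<alpha> y) = ((\<beta> \<circ> \<alpha>) ^^ Suc n) x" by simp
      then show ?thesis unfolding W_def by blast
    qed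
    have O3: "\<alpha> y \<notin> S" if "y \<in> W" for y
    proof
      assume "\<alpha> y \<in> S"
      moreover obtain n where "y = ((\<beta> \<circ> \<alpha>) ^^ n) x" using \<open>y \<in> W\<close> by (auto simp: W_def)
      ultimately have "\<alpha> x \<in> S" using pow_reverse[OF x(1), of n] powS by metis
      with ax show False ..
    qed
    have O4: "\<alpha> y \<notin> W" if "y \<in> W" for y
    proof
      assume "\<alpha> y \<in> W"
      then obtain m where m: "\<alpha> y = ((\<beta> \<circ> \<alpha>) ^^ m) x" by (auto simp: W_def)
      obtain n where n: "y = ((\<beta> \<circ> \<alpha>) ^^ n) x" using \<open>y \<in> W\<close> by (auto simp: W_def)
      have "\<alpha> x = ((\<beta> \<circ> \<alpha>) ^^ (n + m)) x"
        using pow_reverse[OF x(1), of n] unfolding n [symmetric] m by (simp add: funpow_add)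
      with pow_neq[OF x(1)] show False by metis
    qed
    have "\<alpha> y \<notin> W" if "y \<in> S" for y
    proof
      assume "\<alpha> y \<in> W"
      then have "\<alpha> (\<alpha> y) \<notin> S" by (rule O3)
      with that S \<alpha>D show False by auto
    qed
    with O1 O2 O3 O4 S have "S \<union> W \<in> F" by (auto simp: F_def)
    then have "card (S \<union> W) \<le> card S" by (rule max)
    moreover have "x \<in> W" unfolding W_def by (rule range_eqI[of _ _ 0]) simp
    moreover have "finite (S \<union> W)" using S(1) O1 fin by (auto intro: finite_subset)
    ultimately have "S \<union> W = S" by (metis card_seteq sup_ge1)
    with \<open>x \<in> W\<close> x show False by blast
  qed
  then have "transversal X \<alpha> S" using S by (auto simp: transversal_def)
  moreover have "\<beta> x \<in> S \<longleftrightarrow> x \<notin> S" if "x \<in> X" for x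
  proof -
    have inj: "inj_on (\<beta> \<circ> \<alpha>) X"
      by (rule bij_betw_imp_inj_on[OF bij_betw_trans[OF matching_on_bij[OF \<alpha>] matching_on_bij[OF \<beta>]]])
    have "(\<beta> \<circ> \<alpha>) ` S = S"
      using S fin by (intro endo_inj_surj) (auto intro: finite_subset inj_on_subset[OF inj])
    then have "\<beta> (\<alpha> y) \<in> S \<longleftrightarrow> y \<in> S" if "y \<in> X" for y
      using inj_on_image_mem_iff[OF inj that S(1)] by simp
    from this[of "\<alpha> x"] have "\<beta> x \<in> S \<longleftrightarrow> \<alpha> x \<in> S" using that \<alpha>D by simp
    with that cover S show ?thesis by blast
  qed
  ultimately show ?thesis by (auto simp: transversal_def)
qed

abbreviation (input) "loops \<equiv> card (X // (links X \<alpha> \<union> links X \<beta>)\<^sup>*)"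

private lemma closed_iff: "(links X \<alpha> \<union> links X \<beta>) `` T \<subseteq> T \<longleftrightarrow> (\<forall>x\<in>T. \<alpha> x \<in> T \<and> \<beta> x \<in> T)" if "T \<subseteq> X" for T
  using that by (fastforce simp: links_def)

private lemma card_closed:
  "card {T. T \<subseteq> X \<and> (\<forall>x\<in>T. \<alpha> x \<in> T \<and> \<beta> x \<in> T)} = 2 ^ loops"
proof -
  have "{T. T \<subseteq> X \<and> (\<forall>x\<in>T. \<alpha> x \<in> T \<and> \<beta> x \<in> T)} = {T. T \<subseteq> X \<and> (links X \<alpha> \<union> links X \<beta>) `` T \<subseteq> T}"
    using closed_iff by blast
  moreover have "links X \<alpha> \<union> links X \<beta> \<subseteq> X \<times> X" by (auto simp: links_def \<alpha>D \<beta>D)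
  moreover have "sym (links X \<alpha> \<union> links X \<beta>)" using \<alpha> \<beta> by (intro sym_Un sym_links)
  ultimately show ?thesis using card_closed_sets[OF fin] by simp
qed

text \<open>Symmetric difference with one fixed common transversal turns all of them into sets
  closed under both matchings, that is, into unions of curves.\<close>

lemma card_common_transversals: "card {S. transversal X \<alpha> S \<and> transversal X \<beta> S} = 2 ^ loops"
proof -
  obtain S0 where S0: "transversal X \<alpha> S0" "transversal X \<beta> S0" using ex_common_transversal by blast
  have S0': "S0 \<subseteq> X" "\<And>x. x \<in> X \<Longrightarrow> \<alpha> x \<in> S0 \<longleftrightarrow> x \<notin> S0" "\<And>x. x \<in> X \<Longrightarrow> \<beta> x \<in> S0 \<longleftrightarrow> x \<notin> S0"
    using S0 by (auto simp: transversal_def)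
  have closed: "\<alpha> x \<in> T \<longleftrightarrow> x \<in> T" "\<beta> x \<in> T \<longleftrightarrow> x \<in> T"
    if "T \<subseteq> X" "\<forall>x\<in>T. \<alpha> x \<in> T \<and> \<beta> x \<in> T" "x \<in> X" for T x
    using that \<alpha>D(2)[of x] \<beta>D(2)[of x] by metis+
  have "card {S. transversal X \<alpha> S \<and> transversal X \<beta> S} = card {T. T \<subseteq> X \<and> (\<forall>x\<in>T. \<alpha> x \<in> T \<and> \<beta> x \<in> T)}"
  proof (rule bij_betw_same_card, rule bij_betw_byWitness[where f = "\<lambda>S. sym_diff S S0" and f' = "\<lambda>S. sym_diff S S0"])
    show "(\<lambda>S. sym_diff S S0) ` {S. transversal X \<alpha> S \<and> transversal X \<beta> S}
        \<subseteq> {T. T \<subseteq> X \<and> (\<forall>x\<in>T. \<alpha> x \<in> T \<and> \<beta> x \<in> T)}"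
    proof (rule image_subsetI, intro CollectI conjI ballI)
      fix S assume "S \<in> {S. transversal X \<alpha> S \<and> transversal X \<beta> S}"
      then have S: "S \<subseteq> X" "\<And>x. x \<in> X \<Longrightarrow> \<alpha> x \<in> S \<longleftrightarrow> x \<notin> S" "\<And>x. x \<in> X \<Longrightarrow> \<beta> x \<in> S \<longleftrightarrow> x \<notin> S"
        by (auto simp: transversal_def)
      show "sym_diff S S0 \<subseteq> X" using S S0' by blast
      fix x assume x: "x \<in> sym_diff S S0"
      then have "x \<in> X" using S S0' by blast
      with x show "\<alpha> x \<in> sym_diff S S0" "\<beta> x \<in> sym_diff S S0" by (auto simp: S S0')
    qed
    show "(\<lambda>S. sym_diff S S0) ` {T. T \<subseteq> X \<and> (\<forall>x\<in>T. \<alpha> x \<in> T \<and> \<beta> x \<in> T)}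
        \<subseteq> {S. transversal X \<alpha> S \<and> transversal X \<beta> S}"
    proof (rule image_subsetI)
      fix T assume "T \<in> {T. T \<subseteq> X \<and> (\<forall>x\<in>T. \<alpha> x \<in> T \<and> \<beta> x \<in> T)}"
      then have T: "T \<subseteq> X" "\<forall>x\<in>T. \<alpha> x \<in> T \<and> \<beta> x \<in> T" by auto
      have "\<alpha> x \<in> sym_diff T S0 \<longleftrightarrow> x \<notin> sym_diff T S0" "\<beta> x \<in> sym_diff T S0 \<longleftrightarrow> x \<notin> sym_diff T S0"
        if "x \<in> X" for x
        using closed[OF T that] S0'(2,3)[OF that] by auto
      moreover have "sym_diff T S0 \<subseteq> X" using T S0' by blast
      ultimately show "sym_diff T S0 \<in> {S. transversal X \<alpha> S \<and> transversal X \<beta> S}"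
        by (simp only: transversal_def mem_Collect_eq) blast
    qed
  qed auto
  then show ?thesis by (simp add: card_closed)
qed

text \<open>Every curve meets \<open>S\<close> in exactly one cycle of
  \<open>\<beta> \<circ> \<alpha>\<close>: adjoining all \<alpha>-partners matches the invariant
  subsets of \<open>S\<close> with the closed subsets of \<open>X\<close>. So the exponent in
  \<open>sign_eq_invariant_sets\<close> is the number of curves.\<close>

lemma loops_parity:
  assumes S: "transversal X \<alpha> S" "transversal X \<beta> S"
  shows "(-1) ^ loops = sign_on S (\<beta> \<circ> \<alpha>) * (-1) ^ card S"
proof -
  have SX: "S \<subseteq> X" and finS: "finite S" using S fin finite_subset by (auto simp: transversal_def)
  have inS: "\<alpha> x \<in> S \<longleftrightarrow> x \<notin> S" "\<beta> x \<in> S \<longleftrightarrow> x \<notin> S" if "x \<in> X" for x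
    using S that by (auto simp: transversal_def)
  have bij: "bij_betw (\<beta> \<circ> \<alpha>) S S"
    by (rule bij_betw_byWitness[where f' = "\<alpha> \<circ> \<beta>"]) (use SX inS \<alpha>D \<beta>D in \<open>auto simp: subset_iff\<close>)
  define p where "p = restrict_id (\<beta> \<circ> \<alpha>) S"
  have pS: "p x = \<beta> (\<alpha> x)" if "x \<in> S" for x using that by (simp add: p_def)
  have "p permutes S" unfolding p_def by (rule permutes_restrict_id[OF bij])
  from sign_eq_invariant_sets[OF finS this] obtain m where
    m: "card {T. T \<subseteq> S \<and> p ` T \<subseteq> T} = 2 ^ m" "sign p = (-1) ^ (card S + m)" by blast
  have surj: "p ` T = T" if "T \<subseteq> S" "p ` T \<subseteq> T" for T
    using that \<open>p permutes S\<close> finS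
    by (intro endo_inj_surj) (auto intro: finite_subset inj_on_subset[OF permutes_inj_on])
  have "card {T. T \<subseteq> S \<and> p ` T \<subseteq> T} = card {T. T \<subseteq> X \<and> (\<forall>x\<in>T. \<alpha> x \<in> T \<and> \<beta> x \<in> T)}"
  proof (rule bij_betw_same_card, rule bij_betw_byWitness[where f = "\<lambda>T. T \<union> \<alpha> ` T" and f' = "\<lambda>U. U \<inter> S"])
    show "\<forall>T\<in>{T. T \<subseteq> S \<and> p ` T \<subseteq> T}. (T \<union> \<alpha> ` T) \<inter> S = T"
      using inS SX by blast
    show "\<forall>U\<in>{T. T \<subseteq> X \<and> (\<forall>x\<in>T. \<alpha> x \<in> T \<and> \<beta> x \<in> T)}. U \<inter> S \<union> \<alpha> ` (U \<inter> S) = U"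
    proof (intro ballI subset_antisym subsetI)
      fix U x assume "U \<in> {T. T \<subseteq> X \<and> (\<forall>x\<in>T. \<alpha> x \<in> T \<and> \<beta> x \<in> T)}" "x \<in> U"
      then have "x \<in> X" "\<alpha> x \<in> U" by auto
      then show "x \<in> U \<inter> S \<union> \<alpha> ` (U \<inter> S)"
        using inS[of x] \<alpha>D[of x] \<open>x \<in> U\<close> by (cases "x \<in> S") (auto intro!: image_eqI[of _ _ "\<alpha> x"])
    qed auto
    show "(\<lambda>T. T \<union> \<alpha> ` T) ` {T. T \<subseteq> S \<and> p ` T \<subseteq> T} \<subseteq> {T. T \<subseteq> X \<and> (\<forall>x\<in>T. \<alpha> x \<in> T \<and> \<beta> x \<in> T)}"
    proof (rule image_subsetI)
      fix T assume "T \<in> {T. T \<subseteq> S \<and> p ` T \<subseteq> T}"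
      then have T: "T \<subseteq> S" "p ` T \<subseteq> T" by auto
      have "\<beta> x \<in> \<alpha> ` T" if x: "x \<in> T" for x
      proof -
        from surj[OF T] x obtain y where y: "y \<in> T" "x = p y" by blast
        then have "x = \<beta> (\<alpha> y)" using T pS by auto
        then have "\<beta> x = \<alpha> y" using y T SX \<alpha>D \<beta>D by (simp add: subset_iff)
        with y show ?thesis by blast
      qed
      moreover have "\<beta> (\<alpha> x) \<in> T" if "x \<in> T" for x using that T pS[of x] by (metis image_subset_iff subsetD)
      ultimately show "T \<union> \<alpha> ` T \<in> {T. T \<subseteq> X \<and> (\<forall>x\<in>T. \<alpha> x \<in> T \<and> \<beta> x \<in> T)}"
        using T SX \<alpha>D by (auto simp: subset_iff)
    qed
    show "(\<lambda>U. U \<inter> S) ` {T. T \<subseteq> X \<and> (\<forall>x\<in>T. \<alpha> x \<in> T \<and> \<beta> x \<in> T)} \<subseteq> {T. T \<subseteq> S \<and> p ` T \<subseteq> T}"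
      using inS \<alpha>D SX by (auto simp: pS subset_iff)
  qed
  then have "m = loops" using m(1) by (simp add: card_closed)
  with m(2) show ?thesis unfolding sign_on_def p_def [symmetric] by (simp add: power_add)
qed

end

section \<open>Permutation signs compared across transversals\<close>

lemma sign_on_exchange:
  assumes "finite X" "matching_on X \<alpha>" "transversal X \<alpha> A" "transversal X \<alpha> S"
  defines "u \<equiv> \<lambda>x. if (x \<in> A) = (x \<in> S) then x else \<alpha> x"
  shows "bij_betw u X X" "sign_on X u = (-1) ^ card (A - S)"
proof -
  have \<alpha>: "\<alpha> x \<in> X" "\<alpha> (\<alpha> x) = x" "\<alpha> x \<noteq> x" "\<alpha> x \<in> A \<longleftrightarrow> x \<notin> A" "\<alpha> x \<in> S \<longleftrightarrow> x \<notin> S" if "x \<in> X" for x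
    using assms that by (auto simp: matching_on_def transversal_def)
  have AX: "A \<subseteq> X" "S \<subseteq> X" using assms by (auto simp: transversal_def)
  show "bij_betw u X X"
    by (rule bij_betw_byWitness[where f' = u]) (auto simp: u_def \<alpha>)
  \<comment> \<open>\<open>u\<close> swaps the ends of those pairs on which \<open>A\<close> and
    \<open>S\<close> disagree. Such a pair has exactly one end in \<open>A - S\<close>, so
    \<open>u\<close> is a product of \<open>card (A - S)\<close> disjoint transpositions; the subset
    \<open>D\<close> lets them be added one at a time.\<close>
  have "sign (\<lambda>x. if x \<in> D \<or> x \<in> \<alpha> ` D then \<alpha> x else x) = (-1) ^ card D \<and>
      permutation (\<lambda>x. if x \<in> D \<or> x \<in> \<alpha> ` D then \<alpha> x else x)" if "D \<subseteq> A - S" for D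
  proof -
    have "finite D" using that AX assms(1) by (meson Diff_subset finite_subset)
    then show ?thesis using that
    proof (induction D rule: finite_induct)
      case empty
      then show ?case by (simp add: permutation_id[unfolded id_def] )
    next
      case (insert d D)
      let ?f = "\<lambda>D x. if x \<in> D \<or> x \<in> \<alpha> ` D then \<alpha> x else x"
      have d: "d \<in> X" "d \<in> A" "D \<subseteq> X" "D \<subseteq> A" using insert.prems AX by auto
      have notin: "d \<notin> \<alpha> ` D" "\<alpha> d \<notin> D" "\<alpha> d \<notin> \<alpha> ` D"
        using d \<alpha> insert.hyps by (auto simp: subset_iff) (metis \<alpha>(2) subsetD)
      have eq: "?f (insert d D) = transpose d (\<alpha> d) \<circ> ?f D"
      proof
        fix x show "?f (insert d D) x = (transpose d (\<alpha> d) \<circ> ?f D) x"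
        proof (cases "x \<in> D \<or> x \<in> \<alpha> ` D")
          case True
          then have "\<alpha> x \<in> D \<or> \<alpha> x \<in> \<alpha> ` D" using d \<alpha> by (auto simp: subset_iff)
          then have "\<alpha> x \<noteq> d" "\<alpha> x \<noteq> \<alpha> d" using notin insert.hyps by metis+
          with True show ?thesis by (auto simp: transpose_def)
        next
          case False
          then show ?thesis using \<alpha>[OF d(1)] by (auto simp: transpose_def)
        qed
      qed
      have "permutation (?f D)" "sign (?f D) = (-1) ^ card D" using insert by auto
      then show ?case unfolding eq
        using insert.hyps \<alpha>(3)[OF d(1)]
        by (simp add: sign_compose permutation_swap_id permutation_compose sign_swap_id)
    qed
  qed
  from this[OF order_refl] have "sign (\<lambda>x. if x \<in> A - S \<or> x \<in> \<alpha> ` (A - S) then \<alpha> x else x) = (-1) ^ card (A - S)"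
    by blast
  moreover have "restrict_id u X = (\<lambda>x. if x \<in> A - S \<or> x \<in> \<alpha> ` (A - S) then \<alpha> x else x)"
  proof
    fix x
    have "x \<in> \<alpha> ` (A - S) \<longleftrightarrow> x \<in> S - A"
      using AX \<alpha> by (auto simp: image_iff subset_iff intro!: bexI[of _ "\<alpha> x"])
    then show "restrict_id u X x = (if x \<in> A - S \<or> x \<in> \<alpha> ` (A - S) then \<alpha> x else x)"
      using AX by (auto simp: restrict_id_def u_def)
  qed
  ultimately show "sign_on X u = (-1) ^ card (A - S)" by (simp add: sign_on_def)
qed

lemma transversal_card:
  assumes "finite X" "matching_on X \<alpha>" "transversal X \<alpha> S"
  shows "card X = 2 * card S"
proof -
  have "card (X - S) = card (\<alpha> ` S)" using transversal_image[OF assms(2,3)] by simp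
  also have "\<dots> = card S"
    using assms by (intro card_image inj_onI) (metis matching_on_def subsetD transversal_def)
  finally show ?thesis
    using assms card_Diff_subset[of S X] card_mono[of X S] finite_subset[of S X]
    by (auto simp: transversal_def)
qed

text \<open>\<open>f\<close> is corrected by swaps until it preserves \<open>S\<close>, while still
  carrying \<alpha> to \<beta>. On \<open>X - S\<close> the corrected map is
  \<open>\<beta> \<circ> \<alpha>\<close> after the \<alpha>-conjugate of its own restriction to
  \<open>S\<close>, so the sign of that restriction occurs twice in the total and cancels.\<close>

lemma sign_on_matching_iso:
  assumes fin: "finite X" and \<alpha>: "matching_on X \<alpha>" and \<beta>: "matching_on X \<beta>"
    and A: "transversal X \<alpha> A" and B: "transversal X \<beta> B"
    and S: "transversal X \<alpha> S" "transversal X \<beta> S"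
    and f: "bij_betw f X X" "f ` A = B" "\<And>x. x \<in> X \<Longrightarrow> f (\<alpha> x) = \<beta> (f x)"
  shows "sign_on X f * (-1) ^ card (A - S) * (-1) ^ card (B - S) = sign_on (X - S) (\<beta> \<circ> \<alpha>)"
proof -
  define u where "u = (\<lambda>x. if (x \<in> A) = (x \<in> S) then x else \<alpha> x)"
  define v where "v = (\<lambda>x. if (x \<in> B) = (x \<in> S) then x else \<beta> x)"
  \<comment> \<open>\<open>u\<close> carries \<open>S\<close> to \<open>A\<close>, \<open>f\<close>
    carries \<open>A\<close> to \<open>B\<close>, and \<open>v\<close> carries \<open>B\<close> back
    to \<open>S\<close>.\<close>
  define \<kappa> where "\<kappa> = v \<circ> f \<circ> u"
  have \<alpha>D: "\<alpha> x \<in> X" "\<alpha> (\<alpha> x) = x" "\<alpha> x \<in> A \<longleftrightarrow> x \<notin> A" "\<alpha> x \<in> S \<longleftrightarrow> x \<notin> S" if "x \<in> X" for x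
    using \<alpha> A S that by (auto simp: matching_on_def transversal_def)
  have \<beta>D: "\<beta> x \<in> X" "\<beta> (\<beta> x) = x" "\<beta> x \<in> B \<longleftrightarrow> x \<notin> B" "\<beta> x \<in> S \<longleftrightarrow> x \<notin> S" if "x \<in> X" for x
    using \<beta> B S that by (auto simp: matching_on_def transversal_def)
  have fX: "f x \<in> X" if "x \<in> X" for x using f(1) that by (auto dest: bij_betwE)
  have fA: "f x \<in> B \<longleftrightarrow> x \<in> A" if "x \<in> X" for x
  proof
    assume "f x \<in> B"
    then obtain y where "y \<in> A" "f x = f y" using f(2) by blast
    moreover have "A \<subseteq> X" using A by (simp add: transversal_def)
    ultimately show "x \<in> A" using that f(1) by (metis bij_betw_def inj_onD subsetD)
  qed (use f(2) in blast)
  have uX: "u x \<in> X" if "x \<in> X" for x using that \<alpha>D by (simp add: u_def)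
  have uS: "u x \<in> A \<longleftrightarrow> x \<in> S" if "x \<in> X" for x using that \<alpha>D by (auto simp: u_def)
  have vS: "v x \<in> S \<longleftrightarrow> x \<in> B" if "x \<in> X" for x using that \<beta>D by (auto simp: v_def)
  have u\<alpha>: "u (\<alpha> x) = \<alpha> (u x)" if "x \<in> X" for x using that \<alpha>D by (auto simp: u_def)
  have v\<beta>: "v (\<beta> x) = \<beta> (v x)" if "x \<in> X" for x using that \<beta>D by (auto simp: v_def)
  have \<kappa>S: "\<kappa> x \<in> S \<longleftrightarrow> x \<in> S" if "x \<in> X" for x
    using that by (simp add: \<kappa>_def uX fX uS vS fA)
  have \<kappa>\<alpha>: "\<kappa> (\<alpha> x) = \<beta> (\<kappa> x)" if "x \<in> X" for x
    using that by (simp add: \<kappa>_def uX fX u\<alpha> v\<beta> f(3))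
  have u: "bij_betw u X X" "sign_on X u = (-1) ^ card (A - S)"
    unfolding u_def using sign_on_exchange[OF fin \<alpha> A S(1)] by auto
  have v: "bij_betw v X X" "sign_on X v = (-1) ^ card (B - S)"
    unfolding v_def using sign_on_exchange[OF fin \<beta> B S(2)] by auto
  have \<kappa>: "bij_betw \<kappa> X X" unfolding \<kappa>_def using u v f by (auto intro: bij_betw_trans)
  have sgn\<kappa>: "sign_on X \<kappa> = (-1) ^ card (B - S) * (sign_on X f * (-1) ^ card (A - S))"
    unfolding \<kappa>_def comp_assoc
    by (simp only: sign_on_compose[OF v(1) bij_betw_trans[OF u(1) f(1)] fin]
        sign_on_compose[OF f(1) u(1) fin] u(2) v(2))
  have SX: "S \<subseteq> X" using S by (simp add: transversal_def)
  have restr: "bij_betw \<kappa> T T" if "T \<subseteq> X" "\<And>x. x \<in> T \<Longrightarrow> \<kappa> x \<in> T" for T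
  proof -
    have inj: "inj_on \<kappa> T" using \<kappa> that(1) by (auto simp: bij_betw_def intro: inj_on_subset)
    moreover have "\<kappa> ` T = T"
      using that(2) by (intro endo_inj_surj finite_subset[OF that(1) fin] inj) auto
    ultimately show ?thesis by (simp add: bij_betw_def)
  qed
  have \<kappa>1: "bij_betw \<kappa> S S" "bij_betw \<kappa> (X - S) (X - S)"
    using SX \<kappa>S bij_betwE[OF \<kappa>] by (auto intro!: restr)
  have "sign_on X \<kappa> = sign_on S \<kappa> * sign_on (X - S) \<kappa>"
    using sign_on_Un[of S "X - S" \<kappa>] \<kappa>1 fin SX by (simp add: Un_absorb1 finite_subset)
  also have "sign_on (X - S) \<kappa> = sign_on (X - S) ((\<beta> \<circ> \<alpha>) \<circ> (\<alpha> \<circ> \<kappa> \<circ> \<alpha>))"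
  proof (rule sign_on_cong[OF refl])
    fix x assume "x \<in> X - S"
    then have "x \<in> X" "\<kappa> (\<alpha> x) \<in> X" using \<alpha>D bij_betwE[OF \<kappa>] by auto
    then show "\<kappa> x = ((\<beta> \<circ> \<alpha>) \<circ> (\<alpha> \<circ> \<kappa> \<circ> \<alpha>)) x" using \<kappa>\<alpha>[of "\<alpha> x"] \<alpha>D by simp
  qed
  also have "\<dots> = sign_on (X - S) (\<beta> \<circ> \<alpha>) * sign_on (X - S) (\<alpha> \<circ> \<kappa> \<circ> \<alpha>)"
  proof (rule sign_on_compose)
    have \<alpha>1: "bij_betw \<alpha> (X - S) S" "bij_betw \<alpha> S (X - S)"
      by (rule bij_betw_byWitness[where f' = \<alpha>]; use SX \<alpha>D in \<open>auto simp: subset_iff\<close>)+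
    have \<beta>1: "bij_betw \<beta> S (X - S)"
      by (rule bij_betw_byWitness[where f' = \<beta>]; use SX \<beta>D in \<open>auto simp: subset_iff\<close>)
    show "bij_betw (\<beta> \<circ> \<alpha>) (X - S) (X - S)" by (rule bij_betw_trans[OF \<alpha>1(1) \<beta>1])
    show "bij_betw (\<alpha> \<circ> \<kappa> \<circ> \<alpha>) (X - S) (X - S)"
      by (rule bij_betw_trans[OF \<alpha>1(1) bij_betw_trans[OF \<kappa>1(1) \<alpha>1(2)]])
  qed (use fin in auto)
  also have "sign_on (X - S) (\<alpha> \<circ> \<kappa> \<circ> \<alpha>) = sign_on S \<kappa>"
  proof -
    have "sign_on (\<alpha> ` S) (\<alpha> \<circ> \<kappa> \<circ> \<alpha>) = sign_on S \<kappa>"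
    proof (rule sign_on_conj[OF _ \<kappa>1(1)])
      show "finite S" using SX fin by (rule finite_subset)
      show "inj_on \<alpha> S" by (rule inj_on_subset[OF bij_betw_imp_inj_on[OF matching_on_bij[OF \<alpha>]] SX])
    qed (use SX \<alpha>D in auto)
    then show ?thesis using transversal_image[OF \<alpha> S(1)] by simp
  qed
  also have "sign_on S \<kappa> * (sign_on (X - S) (\<beta> \<circ> \<alpha>) * sign_on S \<kappa>) = sign_on (X - S) (\<beta> \<circ> \<alpha>)"
    by (simp add: sign_on_def algebra_simps)
  finally show ?thesis using sgn\<kappa> by (simp add: mult_ac)
qed

text \<open>On the right the transversal enters only through \<open>card (A - S)\<close> and
  \<open>card (B - S)\<close>, which can be counted arc by arc and strand by strand; the sign of
  \<open>f\<close> does not depend on \<open>S\<close>.\<close>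

lemma loops_sign:
  assumes fin: "finite X" and \<alpha>: "matching_on X \<alpha>" and \<beta>: "matching_on X \<beta>"
    and A: "transversal X \<alpha> A" and B: "transversal X \<beta> B"
    and S: "transversal X \<alpha> S" "transversal X \<beta> S"
    and f: "bij_betw f X X" "f ` A = B" "\<And>x. x \<in> X \<Longrightarrow> f (\<alpha> x) = \<beta> (f x)"
  shows "(-1) ^ card (X // (links X \<alpha> \<union> links X \<beta>)\<^sup>*)
    = sign_on X f * (-1) ^ card (A - S) * (-1) ^ card (B - S) * (-1) ^ card A"
proof -
  \<comment> \<open>\<open>sign_on_matching_iso\<close> yields a sign on \<open>X - S\<close>, so
    \<open>loops_parity\<close> is applied to this complement. It has one element per pair, as many
    as \<open>A\<close>.\<close>
  have "transversal X \<alpha> (X - S)" "transversal X \<beta> (X - S)"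
    using transversal_Diff \<alpha> \<beta> S by blast+
  moreover from this have "card (X - S) = card A"
    using transversal_card[OF fin \<alpha>] A by (metis mult_left_cancel zero_neq_numeral)
  ultimately show ?thesis
    using loops_parity[OF fin \<alpha> \<beta>, of "X - S"] sign_on_matching_iso[OF assms] by simp
qed

text \<open>Any bijection from \<open>A\<close> to \<open>B\<close> extends by carrying partners to
  partners.\<close>

lemma ex_matching_iso:
  assumes fin: "finite X" and \<alpha>: "matching_on X \<alpha>" and \<beta>: "matching_on X \<beta>"
    and A: "transversal X \<alpha> A" and B: "transversal X \<beta> B"
  obtains f where "bij_betw f X X" "f ` A = B" "\<And>x. x \<in> X \<Longrightarrow> f (\<alpha> x) = \<beta> (f x)"
proof -
  have AX: "A \<subseteq> X" "B \<subseteq> X" using A B by (auto simp: transversal_def)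
  have "card A = card B"
    using transversal_card[OF fin \<alpha> A] transversal_card[OF fin \<beta> B] by simp
  then obtain h where h: "bij_betw h A B"
    using finite_same_card_bij[of A B] AX fin finite_subset by metis
  have \<alpha>D: "\<alpha> x \<in> X" "\<alpha> (\<alpha> x) = x" "\<alpha> x \<in> A \<longleftrightarrow> x \<notin> A" if "x \<in> X" for x
    using \<alpha> A that by (auto simp: matching_on_def transversal_def)
  have \<beta>D: "\<beta> x \<in> X" "\<beta> (\<beta> x) = x" "\<beta> x \<in> B \<longleftrightarrow> x \<notin> B" if "x \<in> X" for x
    using \<beta> B that by (auto simp: matching_on_def transversal_def)
  have hB: "h x \<in> B" if "x \<in> A" for x using h that by (auto dest: bij_betwE)
  have \<alpha>bij: "bij_betw \<alpha> (X - A) A"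
    by (rule bij_betw_byWitness[where f' = \<alpha>]) (use AX \<alpha>D in auto)
  have \<beta>bij: "bij_betw \<beta> B (X - B)"
    by (rule bij_betw_byWitness[where f' = \<beta>]) (use AX \<beta>D in auto)
  define f where "f = (\<lambda>x. if x \<in> A then h x else (\<beta> \<circ> h \<circ> \<alpha>) x)"
  have 1: "bij_betw f A B" using h by (subst bij_betw_cong[where g = h]) (auto simp: f_def)
  have 2: "bij_betw f (X - A) (X - B)"
    using bij_betw_trans[OF \<alpha>bij bij_betw_trans[OF h \<beta>bij]]
    by (subst bij_betw_cong[where g = "\<beta> \<circ> h \<circ> \<alpha>"]) (auto simp: f_def comp_assoc)
  have "bij_betw f (A \<union> (X - A)) (B \<union> (X - B))"
    by (rule bij_betw_combine[OF 1 2]) auto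
  then have 3: "bij_betw f X X" using AX by (simp add: Un_absorb1)
  have 4: "f (\<alpha> x) = \<beta> (f x)" if "x \<in> X" for x
  proof (cases "x \<in> A")
    case True
    then show ?thesis using that \<alpha>D by (simp add: f_def)
  next
    case False
    then have "h (\<alpha> x) \<in> X" using that \<alpha>D hB AX by blast
    with False that \<alpha>D \<beta>D show ?thesis by (simp add: f_def)
  qed
  show ?thesis by (rule that[OF 3 _ 4]) (use 1 in \<open>auto simp: bij_betw_def\<close>)
qed

lemma sign_on_UNION:
  assumes "finite I" "\<And>i. i \<in> I \<Longrightarrow> finite (Y i)" "\<And>i. i \<in> I \<Longrightarrow> bij_betw f (Y i) (Y i)"
    and "\<And>i j. i \<in> I \<Longrightarrow> j \<in> I \<Longrightarrow> i \<noteq> j \<Longrightarrow> Y i \<inter> Y j = {}"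
  shows "sign_on (\<Union>i\<in>I. Y i) f = (\<Prod>i\<in>I. sign_on (Y i) f) \<and> bij_betw f (\<Union>i\<in>I. Y i) (\<Union>i\<in>I. Y i)"
  using assms
proof (induction I rule: finite_induct)
  case empty
  then show ?case by (simp add: sign_on_def restrict_id_def bij_betw_def)
next
  case (insert i I)
  then have IH: "sign_on (\<Union>i\<in>I. Y i) f = (\<Prod>i\<in>I. sign_on (Y i) f)"
    "bij_betw f (\<Union>i\<in>I. Y i) (\<Union>i\<in>I. Y i)" by auto
  have "Y i \<inter> (\<Union>i\<in>I. Y i) = {}"
  proof -
    have "Y i \<inter> Y j = {}" if "j \<in> I" for j
      using that insert.hyps by (intro insert.prems) auto
    then show ?thesis by blast
  qed
  moreover from this have "bij_betw f (Y i \<union> (\<Union>i\<in>I. Y i)) (Y i \<union> (\<Union>i\<in>I. Y i))"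
    using insert IH by (intro bij_betw_combine) auto
  ultimately show ?case using insert IH by (simp add: sign_on_Un)
qed

section \<open>Counting lemmas\<close>

lemma ex_permutes_image:
  assumes "finite M" "U \<subseteq> M" "V \<subseteq> M" "card U = card V"
  shows "\<exists>p. p permutes M \<and> p ` U = V"
proof -
  have fin: "finite U" "finite V" using assms finite_subset by auto
  obtain f where f: "bij_betw f U V" using finite_same_card_bij[OF fin assms(4)] by blast
  have "card (M - U) = card (M - V)" using assms fin by (simp add: card_Diff_subset)
  then obtain g where g: "bij_betw g (M - U) (M - V)"
    using finite_same_card_bij[of "M - U" "M - V"] assms(1) by auto
  define h where "h x = (if x \<in> U then f x else g x)" for x
  have hU: "bij_betw h U V" using f by (subst bij_betw_cong[where g = f]) (auto simp: h_def)
  have "bij_betw h (M - U) (M - V)" using g by (subst bij_betw_cong[where g = g]) (auto simp: h_def)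
  then have "bij_betw h (U \<union> (M - U)) (V \<union> (M - V))" by (rule bij_betw_combine[OF hU]) auto
  then have "restrict_id h M permutes M" using assms by (intro permutes_restrict_id) (simp add: Un_absorb1)
  moreover have "restrict_id h M ` U = V"
    using hU assms(2) by (auto simp: bij_betw_def restrict_id_def)
  ultimately show ?thesis by blast
qed

text \<open>Composition with a permutation that moves one target set to another shows that all
  targets of the same size are hit equally often. Dividing the number of all permutations by the
  number of targets gives the count.\<close>

lemma card_permutes_image:
  assumes "finite M" "U \<subseteq> M" "V \<subseteq> M" "card U = card V"
  shows "card {p. p permutes M \<and> p ` U = V} = fact (card U) * fact (card M - card U)"
proof -
  define N where "N V = {p. p permutes M \<and> p ` U = V}" for V
  have eq: "card (N V') = card (N V)" if V': "V' \<subseteq> M" "card V' = card U" for V'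
  proof -
    obtain q where q: "q permutes M" "q ` V' = V"
      using ex_permutes_image[OF assms(1) V'(1) assms(3)] V' assms(4) by auto
    have iq: "inv q ` V = V'" unfolding q(2)[symmetric] using permutes_inj[OF q(1)] by (simp add: image_inv_f_f)
    show ?thesis
    proof (rule bij_betw_same_card, rule bij_betw_byWitness[where f = "\<lambda>p. q \<circ> p" and f' = "\<lambda>p. inv q \<circ> p"])
      show "\<forall>p\<in>N V'. inv q \<circ> (q \<circ> p) = p" "\<forall>p\<in>N V. q \<circ> (inv q \<circ> p) = p"
        using permutes_inv_o[OF q(1)] by (simp_all flip: comp_assoc)
      have comp: "(f \<circ> g) ` U = f ` (g ` U)" for f g :: "'a \<Rightarrow> 'a" by (rule image_comp [symmetric])
      show "(\<lambda>p. q \<circ> p) ` N V' \<subseteq> N V"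
        using q by (fastforce simp: N_def comp simp del: image_comp intro: permutes_compose)
      show "(\<lambda>p. inv q \<circ> p) ` N V \<subseteq> N V'"
        using permutes_inv[OF q(1)] iq by (fastforce simp: N_def comp simp del: image_comp intro: permutes_compose)
    qed
  qed
  have "(\<Sum>V' | V' \<subseteq> M \<and> card V' = card U. card (N V')) = card (\<Union>V'\<in>{V'. V' \<subseteq> M \<and> card V' = card U}. N V')"
    using assms(1) by (intro card_UN_disjoint [symmetric])
      (auto simp: N_def intro: finite_subset[OF _ finite_permutations[OF assms(1)]])
  also have "(\<Union>V'\<in>{V'. V' \<subseteq> M \<and> card V' = card U}. N V') = {p. p permutes M}"
  proof (intro subset_antisym subsetI)
    fix p assume "p \<in> {p. p permutes M}"
    then have "p permutes M" by simp
    then have "p ` U \<subseteq> M" "card (p ` U) = card U"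
      using assms(2) by (auto simp: permutes_in_image intro!: card_image inj_on_subset[OF permutes_inj])
    then show "p \<in> (\<Union>V'\<in>{V'. V' \<subseteq> M \<and> card V' = card U}. N V')" using \<open>p permutes M\<close> by (auto simp: N_def)
  qed (auto simp: N_def)
  also have "card \<dots> = fact (card M)" using assms(1) by (simp add: card_permutations)
  finally have "(card M choose card U) * card (N V) = fact (card M)"
    using eq n_subsets[OF assms(1), of "card U"] by simp
  also have "\<dots> = (card M choose card U) * (fact (card U) * fact (card M - card U))"
    using binomial_fact_lemma[of "card U" "card M"] card_mono[OF assms(1,2)] by (simp add: mult_ac)
  finally show ?thesis
    using card_mono[OF assms(1,2)] unfolding N_def by (simp add: binomial_eq_0_iff)
qed

lemma card_permutes_matching:
  "card {p. p permutes {..<m::nat} \<and> (\<forall>i<m. Q (p i) \<longleftrightarrow> P i)} =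
    (if card {i. i < m \<and> P i} = card {i. i < m \<and> Q i}
     then fact (card {i. i < m \<and> P i}) * fact (m - card {i. i < m \<and> P i}) else 0)"
proof -
  let ?U = "{i. i < m \<and> P i}" and ?V = "{i. i < m \<and> Q i}"
  have "(\<forall>i<m. Q (p i) \<longleftrightarrow> P i) \<longleftrightarrow> p ` ?U = ?V" if p: "p permutes {..<m}" for p
  proof -
    have in_m: "p i < m \<longleftrightarrow> i < m" for i using permutes_in_image[OF p] by auto
    have surj: "(\<forall>y. R y) \<longleftrightarrow> (\<forall>i. R (p i))" for R
      using surjD[OF permutes_surj[OF p]] by metis
    have "p ` ?U = ?V \<longleftrightarrow> (\<forall>i. p i \<in> p ` ?U \<longleftrightarrow> p i \<in> ?V)"
      unfolding set_eq_iff by (rule surj)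
    also have "\<dots> \<longleftrightarrow> (\<forall>i. i \<in> ?U \<longleftrightarrow> p i \<in> ?V)"
      by (simp only: inj_image_mem_iff[OF permutes_inj[OF p]])
    finally show ?thesis using in_m by auto
  qed
  then have eq: "{p. p permutes {..<m} \<and> (\<forall>i<m. Q (p i) \<longleftrightarrow> P i)} = {p. p permutes {..<m} \<and> p ` ?U = ?V}"
    by blast
  show ?thesis
  proof (cases "card ?U = card ?V")
    case True
    then show ?thesis unfolding eq by (subst card_permutes_image) auto
  next
    case False
    moreover have "card (p ` ?U) = card ?U" if "p permutes {..<m}" for p
      by (rule card_image[OF inj_on_subset[OF permutes_inj[OF that]]]) simp
    ultimately have "p ` ?U \<noteq> ?V" if "p permutes {..<m}" for p
      using that by metis
    then have empty: "{p. p permutes {..<m} \<and> p ` ?U = ?V} = {}" by blast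
    show ?thesis unfolding eq empty using False by simp
  qed
qed

lemma sum_Pow_card:
  fixes f :: "nat \<Rightarrow> 'b::comm_semiring_1"
  assumes "finite A"
  shows "(\<Sum>B\<in>Pow A. f (card B)) = (\<Sum>p\<le>card A. of_nat (card A choose p) * f p)"
proof -
  have "(\<Sum>B\<in>Pow A. f (card B)) = (\<Sum>p\<le>card A. \<Sum>B | B \<in> Pow A \<and> card B = p. f (card B))"
    by (rule sum.group [symmetric]) (use assms in \<open>auto intro: card_mono\<close>)
  also have "\<dots> = (\<Sum>p\<le>card A. of_nat (card A choose p) * f p)"
    using n_subsets[OF assms] by (intro sum.cong) auto
  finally show ?thesis .
qed

text \<open>Distributivity for independent choices at the half-edges when each vertex contributes a
  factor that sees only its own half-edges.\<close>

lemma sum_PiE_Union: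
  fixes F :: "'a set \<Rightarrow> ('a \<Rightarrow> 'b) \<Rightarrow> 'c::comm_semiring_1"
  assumes "finite \<V>" "\<And>v. v \<in> \<V> \<Longrightarrow> finite v" "\<And>h. h \<in> \<Union>\<V> \<Longrightarrow> finite (B h)" "disjoint \<V>"
  shows "(\<Sum>d\<in>PiE (\<Union>\<V>) B. \<Prod>v\<in>\<V>. F v (restrict d v)) = (\<Prod>v\<in>\<V>. \<Sum>d\<in>PiE v B. F v d)"
proof -
  define w where "w h = (THE v. v \<in> \<V> \<and> h \<in> v)" for h
  have w: "w h = v" if "v \<in> \<V>" "h \<in> v" for h v
    unfolding w_def using that assms(4) by (intro the_equality) (auto simp: disjoint_def)
  have "(\<Prod>v\<in>\<V>. \<Sum>d\<in>PiE v B. F v d) = (\<Sum>G\<in>PiE \<V> (\<lambda>v. PiE v B). \<Prod>v\<in>\<V>. F v (G v))"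
    using assms by (intro prod_sum_PiE finite_PiE) auto
  also have "\<dots> = (\<Sum>d\<in>PiE (\<Union>\<V>) B. \<Prod>v\<in>\<V>. F v (restrict d v))"
  proof (rule sum.reindex_bij_witness[where j = "\<lambda>G. \<lambda>h\<in>\<Union>\<V>. G (w h) h" and i = "\<lambda>d. \<lambda>v\<in>\<V>. restrict d v"])
    fix G assume G: "G \<in> PiE \<V> (\<lambda>v. PiE v B)"
    have GB: "G v h \<in> B h" if "v \<in> \<V>" "h \<in> v" for v h
      using PiE_mem[OF PiE_mem[OF G that(1)] that(2)] .
    have *: "restrict (\<lambda>h\<in>\<Union>\<V>. G (w h) h) v = G v" if "v \<in> \<V>" for v
    proof
      fix h show "restrict (\<lambda>h\<in>\<Union>\<V>. G (w h) h) v h = G v h"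
        using that w[OF that] PiE_arb[OF PiE_mem[OF G that], of h] by (cases "h \<in> v") auto
    qed
    show "(\<lambda>v\<in>\<V>. restrict (\<lambda>h\<in>\<Union>\<V>. G (w h) h) v) = G"
    proof
      fix v show "(\<lambda>v\<in>\<V>. restrict (\<lambda>h\<in>\<Union>\<V>. G (w h) h) v) v = G v"
        using * PiE_arb[OF G] by (cases "v \<in> \<V>") auto
    qed
    show "(\<lambda>h\<in>\<Union>\<V>. G (w h) h) \<in> PiE (\<Union>\<V>) B"
      using w GB by auto
    show "(\<Prod>v\<in>\<V>. F v (restrict (\<lambda>h\<in>\<Union>\<V>. G (w h) h) v)) = (\<Prod>v\<in>\<V>. F v (G v))"
      using * by (intro prod.cong) auto
  next
    fix d assume d: "d \<in> PiE (\<Union>\<V>) B"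
    show "(\<lambda>h\<in>\<Union>\<V>. (\<lambda>v\<in>\<V>. restrict d v) (w h) h) = d"
    proof
      fix h show "(\<lambda>h\<in>\<Union>\<V>. (\<lambda>v\<in>\<V>. restrict d v) (w h) h) h = d h"
      proof (cases "h \<in> \<Union>\<V>")
        case True
        then obtain v where "v \<in> \<V>" "h \<in> v" by blast
        with w[OF this] show ?thesis by auto
      qed (use PiE_arb[OF d] in auto)
    qed
    show "(\<lambda>v\<in>\<V>. restrict d v) \<in> PiE \<V> (\<lambda>v. PiE v B)"
      by (auto intro!: PiE_mem[OF d])
  qed
  finally show ?thesis ..
qed

lemma sum_PiE_three:
  assumes "a \<noteq> b" "a \<noteq> c" "b \<noteq> c"
  shows "(\<Sum>d\<in>PiE {a, b, c} B. F (d a) (d b) (d c)) = (\<Sum>p\<in>B a. \<Sum>q\<in>B b. \<Sum>r\<in>B c. F p q r)"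
proof -
  have "(\<Sum>d\<in>PiE {a, b, c} B. F (d a) (d b) (d c)) = (\<Sum>(p, q, r)\<in>B a \<times> B b \<times> B c. F p q r)"
    by (rule sum.reindex_bij_witness[where j = "\<lambda>d. (d a, d b, d c)"
        and i = "\<lambda>(p, q, r). \<lambda>x\<in>{a, b, c}. if x = a then p else if x = b then q else r"])
      (use assms in \<open>auto simp: PiE_iff extensional_def fun_eq_iff\<close>)
  then show ?thesis by (simp add: sum.cartesian_product)
qed

section \<open>The state sum\<close>

locale spin =
  fixes E :: "'e set" and R :: "'e \<times> bool \<Rightarrow> 'e \<times> bool" and \<gamma> :: "'e \<Rightarrow> nat"
  assumes spin: "spin_network E R \<gamma>"
begin

section \<open>Arcs at the vertices\<close>

abbreviation "H \<equiv> half_edges E"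
abbreviation "g h \<equiv> \<gamma> (fst h)"
abbreviation "X \<equiv> strand_ends E \<gamma>"
abbreviation "\<alpha> \<equiv> vertex_partner R \<gamma>"

text \<open>At a half-edge \<open>h\<close> the strands with index below \<open>y h\<close> turn to \<open>R (R h)\<close>, the remaining
  \<open>z h\<close> strands turn to \<open>R h\<close>.\<close>

definition y where "y h = (g h + g (R (R h)) - g (R h)) div 2"
definition z where "z h = (g h + g (R h) - g (R (R h))) div 2"

lemma finE: "finite E" and R_permutes: "R permutes H"
  and R_R_R: "h \<in> H \<Longrightarrow> R (R (R h)) = h" and R_neq: "h \<in> H \<Longrightarrow> R h \<noteq> h"
  using spin by (auto simp: spin_network_def cubic_ribbon_graph_def)

lemma finH: "finite H" by (simp add: half_edges_def finE)

lemma R_in: "h \<in> H \<Longrightarrow> R h \<in> H" using R_permutes by (simp add: permutes_in_image)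

lemma R_R_neq: "h \<in> H \<Longrightarrow> R (R h) \<noteq> h" using R_R_R[of h] R_neq[of h] by auto

lemma R_R_neq_R: "h \<in> H \<Longrightarrow> R (R h) \<noteq> R h" using R_neq[OF R_in] by auto

lemma finX: "finite X"
proof (rule finite_subset)
  show "X \<subseteq> (SIGMA h:H. {..<g h})" by (auto simp: strand_ends_def)
qed (auto intro: finH)

lemma in_X: "(h, i) \<in> X \<longleftrightarrow> h \<in> H \<and> i < g h" by (auto simp: strand_ends_def)

text \<open>Admissibility makes the truncated subtractions and the halvings exact: with
  \<open>s\<close> half the sum of the decorations \<open>a\<close>, \<open>b\<close>,
  \<open>c\<close>, the bundles of arcs have \<open>s - a\<close>, \<open>s - b\<close> and
  \<open>s - c\<close> members. The equation \<open>z h = y (R h)\<close> counts the bundle between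
  \<open>h\<close> and \<open>R h\<close> from both sides.\<close>

lemma yz:
  assumes "h \<in> H"
  shows "z h = y (R h)" "y h + z h = g h" "g h + g (R h) + g (R (R h)) = 2 * (z h + z (R h) + z (R (R h)))"
    "g (R h) = z h + z (R h)" "g (R (R h)) = z (R h) + z (R (R h))" "y h = z (R (R h))"
proof -
  have adm: "even (g h + g (R h) + g (R (R h))) \<and> \<bar>int (g h) - int (g (R h))\<bar> \<le> int (g (R (R h))) \<and>
      g (R (R h)) \<le> g h + g (R h)"
    using spin assms by (auto simp: spin_network_def admissible_def Let_def)
  define a b c where "a = g h" and "b = g (R h)" and "c = g (R (R h))"
  have le: "a \<le> b + c" "b \<le> a + c" "c \<le> a + b" "even (a + b + c)"
    using adm by (auto simp: a_def b_def c_def)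
  have eqs: "y h = (a + c - b) div 2" "z h = (a + b - c) div 2"
    "y (R h) = (b + a - c) div 2" "z (R h) = (b + c - a) div 2" "z (R (R h)) = (c + a - b) div 2"
    by (simp_all add: y_def z_def a_def b_def c_def R_R_R[OF assms])
  obtain s where s: "a + b + c = 2 * s" using le(4) by (blast elim: evenE)
  from le s have "a + c - b = 2 * (s - b)" "a + b - c = 2 * (s - c)" "b + a - c = 2 * (s - c)"
    "b + c - a = 2 * (s - a)" "c + a - b = 2 * (s - b)" by auto
  then have eqs': "y h = s - b" "z h = s - c" "y (R h) = s - c" "z (R h) = s - a" "z (R (R h)) = s - b"
    by (auto simp: eqs)
  show "z h = y (R h)" "y h + z h = g h" "g h + g (R h) + g (R (R h)) = 2 * (z h + z (R h) + z (R (R h)))"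
    "g (R h) = z h + z (R h)" "g (R (R h)) = z (R h) + z (R (R h))" "y h = z (R (R h))"
    using le s by (simp_all add: eqs' flip: a_def b_def c_def)
qed

lemma \<alpha>_simp: "\<alpha> (h, i) = (if i < y h then (R (R h), g (R (R h)) - 1 - i) else (R h, g h - 1 - i))"
  by (simp add: vertex_partner_def y_def Let_def)

text \<open>Every arc joins some \<open>h\<close> to \<open>R h\<close>; the rotation singles out
  its end at \<open>h\<close>.\<close>

definition A where "A = {(h, i). (h, i) \<in> X \<and> y h \<le> i}"

lemma partner_low:
  assumes "h \<in> H" "i < y h"
  shows "g (R (R h)) - 1 - i < g (R (R h))" "y (R (R h)) \<le> g (R (R h)) - 1 - i"
    "g (R (R h)) - 1 - (g (R (R h)) - 1 - i) = i"
proof -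
  let ?h = "R (R h)"
  have "y ?h + z ?h = g ?h" "z ?h = y h"
    using yz[of ?h] yz[of h] assms R_in by auto
  with assms show "g (R (R h)) - 1 - i < g (R (R h))" "y (R (R h)) \<le> g (R (R h)) - 1 - i"
    "g (R (R h)) - 1 - (g (R (R h)) - 1 - i) = i" by auto
qed

lemma partner_high:
  assumes "h \<in> H" "i < g h" "y h \<le> i"
  shows "g h - 1 - i < y (R h)" "g h - 1 - i < g (R h)" "g h - 1 - (g h - 1 - i) = i"
proof -
  have "y h + z h = g h" "z h = y (R h)" "y (R h) + z (R h) = g (R h)"
    using yz[of h] yz[of "R h"] assms R_in by auto
  with assms show "g h - 1 - i < y (R h)" "g h - 1 - i < g (R h)" "g h - 1 - (g h - 1 - i) = i" by auto
qed

lemma matching_\<alpha>: "matching_on X \<alpha>"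
  unfolding matching_on_def
proof (rule ballI)
  fix x assume "x \<in> X"
  then obtain h i where x: "x = (h, i)" "h \<in> H" "i < g h" by (cases x) (auto simp: in_X)
  show "\<alpha> x \<in> X \<and> \<alpha> (\<alpha> x) = x \<and> \<alpha> x \<noteq> x"
  proof (cases "i < y h")
    case True
    have "\<not> g (R (R h)) - 1 - i < y (R (R h))" using partner_low[OF x(2) True] by simp
    then show ?thesis
      unfolding x(1) using True partner_low[OF x(2) True] x(2,3) R_in R_R_neq[OF x(2)]
      by (simp only: \<alpha>_simp in_X if_True if_False R_R_R prod.inject simp_thms)
  next
    case False
    then have "y h \<le> i" by simp
    note p = partner_high[OF x(2,3) this]
    show ?thesis
      unfolding x(1) using False p x(2,3) R_in R_neq[OF x(2)]
      by (simp only: \<alpha>_simp in_X if_True if_False R_R_R prod.inject simp_thms)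
  qed
qed

lemma transversal_A: "transversal X \<alpha> A"
  unfolding transversal_def
proof (intro conjI ballI)
  show "A \<subseteq> X" by (auto simp: A_def)
  fix x assume "x \<in> X"
  then obtain h i where x: "x = (h, i)" "h \<in> H" "i < g h" by (cases x) (auto simp: in_X)
  show "\<alpha> x \<in> A \<longleftrightarrow> x \<notin> A"
  proof (cases "i < y h")
    case True
    have "x \<notin> A" using True by (simp add: A_def x)
    moreover have "\<alpha> x \<in> A"
      unfolding x(1) using True partner_low[OF x(2) True] x(2) R_in
      by (simp only: \<alpha>_simp A_def in_X if_True mem_Collect_eq prod.case simp_thms)
    ultimately show ?thesis by simp
  next
    case False
    then have hi: "y h \<le> i" by simp
    have "x \<in> A" using hi x by (simp add: A_def in_X)
    moreover have "\<alpha> x \<notin> A"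
      unfolding x(1) using False partner_high[OF x(2,3) hi]
      by (simp add: \<alpha>_simp A_def)
    ultimately show ?thesis by simp
  qed
qed

section \<open>Strands along the edges\<close>

definition \<beta> :: "('e \<Rightarrow> nat \<Rightarrow> nat) \<Rightarrow> ('e \<times> bool) \<times> nat \<Rightarrow> ('e \<times> bool) \<times> nat" where
  "\<beta> \<sigma> x = (case x of ((e, s), i) \<Rightarrow>
     if s then ((e, False), inv (\<sigma> e) (\<gamma> e - 1 - i)) else ((e, True), \<gamma> e - 1 - \<sigma> e i))"

definition B where "B = {x \<in> X. \<not> snd (fst x)}"

definition eperm where "eperm \<sigma> \<longleftrightarrow> (\<forall>e\<in>E. \<sigma> e permutes {..<\<gamma> e})"

lemma in_X': "((e, s), i) \<in> X \<longleftrightarrow> e \<in> E \<and> i < \<gamma> e" by (auto simp: in_X half_edges_def)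

lemma \<beta>_simps: "\<beta> \<sigma> ((e, False), i) = ((e, True), \<gamma> e - 1 - \<sigma> e i)"
  "\<beta> \<sigma> ((e, True), i) = ((e, False), inv (\<sigma> e) (\<gamma> e - 1 - i))"
  by (auto simp: \<beta>_def)

lemma eperm_facts:
  assumes "eperm \<sigma>" "e \<in> E"
  shows "\<sigma> e i < \<gamma> e \<longleftrightarrow> i < \<gamma> e" "inv (\<sigma> e) i < \<gamma> e \<longleftrightarrow> i < \<gamma> e"
    "inv (\<sigma> e) (\<sigma> e i) = i" "\<sigma> e (inv (\<sigma> e) i) = i"
proof -
  have p: "\<sigma> e permutes {..<\<gamma> e}" using assms by (simp add: eperm_def)
  show "\<sigma> e i < \<gamma> e \<longleftrightarrow> i < \<gamma> e" "inv (\<sigma> e) i < \<gamma> e \<longleftrightarrow> i < \<gamma> e"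
    using permutes_in_image[OF p, of i] permutes_in_image[OF permutes_inv[OF p], of i] by auto
  show "inv (\<sigma> e) (\<sigma> e i) = i" "\<sigma> e (inv (\<sigma> e) i) = i"
    using permutes_inverses[OF p] by auto
qed

lemma X_cases:
  assumes "x \<in> X"
  obtains e i where "x = ((e, False), i)" "e \<in> E" "i < \<gamma> e" | e i where "x = ((e, True), i)" "e \<in> E" "i < \<gamma> e"
proof -
  obtain e s i where "x = ((e, s), i)" by (cases x) auto
  with assms that show ?thesis by (cases s) (auto simp: in_X')
qed

lemma matching_\<beta>: assumes "eperm \<sigma>" shows "matching_on X (\<beta> \<sigma>)"
  unfolding matching_on_def
proof (rule ballI)
  fix x assume "x \<in> X"
  then show "\<beta> \<sigma> x \<in> X \<and> \<beta> \<sigma> (\<beta> \<sigma> x) = x \<and> \<beta> \<sigma> x \<noteq> x"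
  proof (cases rule: X_cases)
    case (1 e i)
    have "\<sigma> e i < \<gamma> e" using eperm_facts[OF assms, of e i] 1 by simp
    then have "\<gamma> e - 1 - (\<gamma> e - 1 - \<sigma> e i) = \<sigma> e i" "\<gamma> e - 1 - \<sigma> e i < \<gamma> e" by auto
    with 1 eperm_facts[OF assms, of e i] show ?thesis by (simp add: \<beta>_simps in_X')
  next
    case (2 e i)
    then have "\<gamma> e - 1 - (\<gamma> e - 1 - i) = i" "\<gamma> e - 1 - i < \<gamma> e" by auto
    with 2 eperm_facts[OF assms, of e "\<gamma> e - 1 - i"] show ?thesis by (simp add: \<beta>_simps in_X')
  qed
qed

lemma transversal_B: assumes "eperm \<sigma>" shows "transversal X (\<beta> \<sigma>) B"
proof -
  have "\<beta> \<sigma> x \<in> X" if "x \<in> X" for x using matching_\<beta>[OF assms] that by (simp add: matching_on_def)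
  then show ?thesis by (auto simp: transversal_def B_def \<beta>_def split: prod.splits)
qed

text \<open>\<open>edge_links\<close> records each strand from its \<open>False\<close> end only;
  the symmetric closure taken in \<open>num_curves\<close> completes it to the matching
  \<open>\<beta> \<sigma>\<close>.\<close>

lemma num_curves_eq:
  assumes "eperm \<sigma>"
  shows "num_curves E R \<gamma> \<sigma> = card (X // (links X \<alpha> \<union> links X (\<beta> \<sigma>))\<^sup>*)"
proof -
  have vl: "vertex_links E R \<gamma> = links X \<alpha>" by (simp add: vertex_links_def links_def)
  have "links X \<alpha> = (links X \<alpha>)\<inverse>" using sym_links[OF matching_\<alpha>] by (simp add: sym_conv_converse_eq)
  moreover have "links X (\<beta> \<sigma>) = edge_links E \<gamma> \<sigma> \<union> (edge_links E \<gamma> \<sigma>)\<inverse>"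
  proof (intro subset_antisym subsetI)
    fix p assume "p \<in> links X (\<beta> \<sigma>)"
    then obtain x where x: "x \<in> X" "p = (x, \<beta> \<sigma> x)" by (auto simp: links_def)
    from x(1) show "p \<in> edge_links E \<gamma> \<sigma> \<union> (edge_links E \<gamma> \<sigma>)\<inverse>"
    proof (cases rule: X_cases)
      case (1 e i)
      then show ?thesis by (auto simp: x edge_links_def \<beta>_simps)
    next
      case (2 e j)
      define i where "i = inv (\<sigma> e) (\<gamma> e - 1 - j)"
      have "\<gamma> e - 1 - j < \<gamma> e" "j = \<gamma> e - 1 - (\<gamma> e - 1 - j)" using 2 by auto
      then have "i < \<gamma> e" "j = \<gamma> e - 1 - \<sigma> e i"
        using eperm_facts[OF assms 2(2)] unfolding i_def by simp_all
      with 2 have "(((e, False), i), ((e, True), j)) \<in> edge_links E \<gamma> \<sigma>" by (auto simp: edge_links_def)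
      then show ?thesis by (simp add: x 2 \<beta>_simps i_def)
    qed
  next
    fix p assume p: "p \<in> edge_links E \<gamma> \<sigma> \<union> (edge_links E \<gamma> \<sigma>)\<inverse>"
    have sub: "edge_links E \<gamma> \<sigma> \<subseteq> links X (\<beta> \<sigma>)"
    proof
      fix q assume "q \<in> edge_links E \<gamma> \<sigma>"
      then obtain e i where "q = (((e, False), i), \<beta> \<sigma> ((e, False), i))" "e \<in> E" "i < \<gamma> e"
        by (auto simp: edge_links_def \<beta>_simps)
      then show "q \<in> links X (\<beta> \<sigma>)" unfolding links_def by (auto simp only: in_X')
    qed
    with sym_links[OF matching_\<beta>[OF assms]] have "(edge_links E \<gamma> \<sigma>)\<inverse> \<subseteq> links X (\<beta> \<sigma>)"
      by (auto dest: symD)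
    with sub p show "p \<in> links X (\<beta> \<sigma>)" by blast
  qed
  ultimately have "vertex_links E R \<gamma> \<union> edge_links E \<gamma> \<sigma> \<union> (vertex_links E R \<gamma> \<union> edge_links E \<gamma> \<sigma>)\<inverse>
      = links X \<alpha> \<union> links X (\<beta> \<sigma>)" unfolding vl by blast
  then show ?thesis by (simp add: num_curves_def Let_def)
qed

text \<open>Conjugates the matching of the straight strands to the matching twisted by \<open>\<sigma>\<close>, which is how
  the signs of the permutations enter.\<close>

definition twist :: "('e \<Rightarrow> nat \<Rightarrow> nat) \<Rightarrow> ('e \<times> bool) \<times> nat \<Rightarrow> ('e \<times> bool) \<times> nat" where
  "twist \<sigma> x = (case x of ((e, s), i) \<Rightarrow> if s then x else ((e, s), inv (\<sigma> e) i))"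

lemma twist_simps: "twist \<sigma> ((e, True), i) = ((e, True), i)" "twist \<sigma> ((e, False), i) = ((e, False), inv (\<sigma> e) i)"
  by (auto simp: twist_def)

lemma sign_twist:
  assumes "eperm \<sigma>"
  shows "sign_on X (twist \<sigma>) = (\<Prod>e\<in>E. sign (\<sigma> e))" "bij_betw (twist \<sigma>) X X" "twist \<sigma> ` B = B"
proof -
  define Y where "Y e = (\<lambda>i. ((e, False), i)) ` {..<\<gamma> e}" for e
  have BY: "B = (\<Union>e\<in>E. Y e)" by (auto simp: B_def Y_def in_X' elim!: X_cases)
  have perm: "inv (\<sigma> e) permutes {..<\<gamma> e}" if "e \<in> E" for e
    using assms that by (auto simp: eperm_def intro: permutes_inv)
  have "bij_betw (twist \<sigma>) (Y e) (Y e)" if "e \<in> E" for e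
    by (rule bij_betw_byWitness[where f' = "\<lambda>((e, s), i). ((e, s), \<sigma> e i)"])
      (use eperm_facts[OF assms that] in \<open>auto simp: Y_def twist_simps\<close>)
  then have U: "sign_on B (twist \<sigma>) = (\<Prod>e\<in>E. sign_on (Y e) (twist \<sigma>)) \<and> bij_betw (twist \<sigma>) B B"
    unfolding BY by (intro sign_on_UNION finE) (auto simp: Y_def)
  have "sign_on (Y e) (twist \<sigma>) = sign (\<sigma> e)" if e: "e \<in> E" for e
  proof -
    have "sign_on (Y e) (twist \<sigma>) = sign_on {..<\<gamma> e} (inv (\<sigma> e))"
      unfolding Y_def using permutes_imp_bij[OF perm[OF e]]
      by (intro sign_on_conj) (auto simp: inj_on_def twist_simps)
    also have "\<dots> = sign (inv (\<sigma> e))" by (rule sign_on_permutes[OF perm[OF e]]) simp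
    also have "\<dots> = sign (\<sigma> e)"
      using assms e by (intro sign_inverse permutes_imp_permutation[of "{..<\<gamma> e}"]) (auto simp: eperm_def)
    finally show ?thesis .
  qed
  then have signB: "sign_on B (twist \<sigma>) = (\<Prod>e\<in>E. sign (\<sigma> e))" using U by simp
  have id: "twist \<sigma> x = x" if "x \<in> X - B" for x
    using that by (auto simp: B_def twist_simps elim!: X_cases)
  have "bij_betw (twist \<sigma>) (X - B) (X - B)"
    by (subst bij_betw_cong[where g = "\<lambda>x. x"]) (auto simp: id bij_betw_def)
  moreover have BX: "B \<union> (X - B) = X" "finite B" using finX by (auto simp: B_def)
  ultimately have "bij_betw (twist \<sigma>) (B \<union> (X - B)) (B \<union> (X - B))"
    "sign_on (B \<union> (X - B)) (twist \<sigma>) = sign_on B (twist \<sigma>) * sign_on (X - B) (twist \<sigma>)"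
    using U finX bij_betw_combine[of "twist \<sigma>" B B "X - B" "X - B"]
      sign_on_Un[of B "X - B" "twist \<sigma>"] by blast+
  moreover have "sign_on (X - B) (twist \<sigma>) = sign_on (X - B) (\<lambda>x. x)" by (rule sign_on_cong) (auto simp: id)
  ultimately show "sign_on X (twist \<sigma>) = (\<Prod>e\<in>E. sign (\<sigma> e))" "bij_betw (twist \<sigma>) X X" "twist \<sigma> ` B = B"
    using U unfolding BX by (auto simp: signB bij_betw_def)
qed

lemma twist_\<beta>:
  assumes "eperm \<sigma>" "x \<in> X"
  shows "twist \<sigma> (\<beta> (\<lambda>_. id) x) = \<beta> \<sigma> (twist \<sigma> x)"
  using assms(2) by (cases rule: X_cases) (auto simp: \<beta>_simps twist_simps eperm_facts[OF assms(1)])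

text \<open>A fixed isomorphism \<open>f\<close> from the arcs to the untwisted strands is followed
  by \<open>twist \<sigma>\<close>, which leads on to the strands of \<sigma>. The sign of the twist
  is the product of the \<open>sign (\<sigma> e)\<close>, which cancels the same product on the
  left; what remains of the isomorphism is a constant independent of \<sigma> and
  \<open>S\<close>.\<close>

lemma loop_sign:
  obtains c :: int where "\<bar>c\<bar> = 1"
    "\<And>\<sigma> S. eperm \<sigma> \<Longrightarrow> transversal X \<alpha> S \<Longrightarrow> transversal X (\<beta> \<sigma>) S \<Longrightarrow>
      (\<Prod>e\<in>E. sign (\<sigma> e)) * (-1) ^ num_curves E R \<gamma> \<sigma> = c * (-1) ^ card (A - S) * (-1) ^ card (B - S)"
proof -
  have id: "eperm (\<lambda>_. id)" by (simp add: eperm_def permutes_id)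
  obtain f where f: "bij_betw f X X" "f ` A = B" "\<And>x. x \<in> X \<Longrightarrow> f (\<alpha> x) = \<beta> (\<lambda>_. id) (f x)"
    using ex_matching_iso[OF finX matching_\<alpha> matching_\<beta>[OF id] transversal_A transversal_B[OF id]] by blast
  define c where "c = sign_on X f * (-1) ^ card A"
  have "(\<Prod>e\<in>E. sign (\<sigma> e)) * (-1) ^ num_curves E R \<gamma> \<sigma> = c * (-1) ^ card (A - S) * (-1) ^ card (B - S)"
    if \<sigma>: "eperm \<sigma>" and S: "transversal X \<alpha> S" "transversal X (\<beta> \<sigma>) S" for \<sigma> S
  proof -
    have t: "sign_on X (twist \<sigma>) = (\<Prod>e\<in>E. sign (\<sigma> e))" "bij_betw (twist \<sigma>) X X" "twist \<sigma> ` B = B"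
      by (rule sign_twist[OF \<sigma>])+
    have bij: "bij_betw (twist \<sigma> \<circ> f) X X" by (rule bij_betw_trans[OF f(1) t(2)])
    have im: "(twist \<sigma> \<circ> f) ` A = B" using f(2) t(3) by (metis image_comp)
    have comm: "(twist \<sigma> \<circ> f) (\<alpha> x) = \<beta> \<sigma> ((twist \<sigma> \<circ> f) x)" if "x \<in> X" for x
    proof -
      have "f x \<in> X" using that f(1) by (auto dest: bij_betwE)
      then show ?thesis using f(3)[OF that] twist_\<beta>[OF \<sigma>] by simp
    qed
    have "(-1) ^ num_curves E R \<gamma> \<sigma> =
        sign_on X (twist \<sigma> \<circ> f) * (-1) ^ card (A - S) * (-1) ^ card (B - S) * (-1) ^ card A"
      unfolding num_curves_eq[OF \<sigma>]
      by (rule loops_sign[OF finX matching_\<alpha> matching_\<beta>[OF \<sigma>] transversal_A transversal_B[OF \<sigma>] S bij im comm])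
    also have "sign_on X (twist \<sigma> \<circ> f) = (\<Prod>e\<in>E. sign (\<sigma> e)) * sign_on X f"
      using sign_on_compose[OF t(2) f(1) finX] t(1) by simp
    finally have "(\<Prod>e\<in>E. sign (\<sigma> e)) * (-1) ^ num_curves E R \<gamma> \<sigma> =
        ((\<Prod>e\<in>E. sign (\<sigma> e)) * (\<Prod>e\<in>E. sign (\<sigma> e))) * (c * (-1) ^ card (A - S) * (-1) ^ card (B - S))"
      by (simp only: c_def mult_ac)
    also have "(\<Prod>e\<in>E. sign (\<sigma> e)) * (\<Prod>e\<in>E. sign (\<sigma> e)) = 1"
      by (simp flip: prod.distrib)
    finally show ?thesis by simp
  qed
  moreover have "\<bar>c\<bar> = 1" by (simp add: c_def abs_mult power_abs sign_on_def)
  ultimately show ?thesis using that by blast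
qed

section \<open>Spin counts and summation over the permutations\<close>

definition cnt where "cnt S h = card {i. i < g h \<and> (h, i) \<in> S}"

lemma cnt_le: "cnt S h \<le> g h"
  unfolding cnt_def by (rule order_trans[OF card_mono[of "{..<g h}"]]) auto

lemma card_not_in: "card {i. i < \<gamma> e \<and> ((e, s), i) \<notin> S} = \<gamma> e - cnt S (e, s)"
proof -
  have "{i. i < \<gamma> e \<and> ((e, s), i) \<notin> S} = {..<\<gamma> e} - {i. i < \<gamma> e \<and> ((e, s), i) \<in> S}" by auto
  then show ?thesis by (simp add: cnt_def card_Diff_subset subset_iff)
qed

lemma card_reflect: "card {i. i < \<gamma> e \<and> ((e, s), \<gamma> e - 1 - i) \<in> S} = cnt S (e, s)"
  unfolding cnt_def fst_conv
  by (rule bij_betw_same_card[of "\<lambda>i. \<gamma> e - 1 - i"], rule bij_betw_byWitness[where f' = "\<lambda>i. \<gamma> e - 1 - i"]) auto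

lemma transversal_\<beta>_iff:
  assumes "eperm \<sigma>" "S \<subseteq> X"
  shows "transversal X (\<beta> \<sigma>) S \<longleftrightarrow>
    (\<forall>e\<in>E. \<forall>i<\<gamma> e. ((e, True), \<gamma> e - 1 - \<sigma> e i) \<in> S \<longleftrightarrow> ((e, False), i) \<notin> S)"
proof
  assume "transversal X (\<beta> \<sigma>) S"
  then have *: "\<beta> \<sigma> x \<in> S \<longleftrightarrow> x \<notin> S" if "x \<in> X" for x using that by (auto simp: transversal_def)
  show "\<forall>e\<in>E. \<forall>i<\<gamma> e. ((e, True), \<gamma> e - 1 - \<sigma> e i) \<in> S \<longleftrightarrow> ((e, False), i) \<notin> S"
    using *[of "((_, False), _)"] by (simp add: \<beta>_simps in_X')
next
  assume *: "\<forall>e\<in>E. \<forall>i<\<gamma> e. ((e, True), \<gamma> e - 1 - \<sigma> e i) \<in> S \<longleftrightarrow> ((e, False), i) \<notin> S"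
  have "\<beta> \<sigma> x \<in> S \<longleftrightarrow> x \<notin> S" if "x \<in> X" for x
    using that
  proof (cases rule: X_cases)
    case (1 e i)
    with * show ?thesis by (simp add: \<beta>_simps)
  next
    case (2 e j)
    have j: "\<gamma> e - 1 - j < \<gamma> e" "\<gamma> e - 1 - (\<gamma> e - 1 - j) = j" using 2 by auto
    with *[rule_format, OF 2(2), of "inv (\<sigma> e) (\<gamma> e - 1 - j)"] eperm_facts[OF assms(1) 2(2)] 2
    show ?thesis by (simp add: \<beta>_simps del: One_nat_def diff_diff_left)
  qed
  with assms(2) show "transversal X (\<beta> \<sigma>) S" by (simp add: transversal_def)
qed

text \<open>The number of permutations of \<open>m\<close> strands that join up ends to down ends,
  given \<open>k\<close> up ends on one side and \<open>l\<close> on the other.\<close>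

definition edge_weight :: "nat \<Rightarrow> nat \<Rightarrow> nat \<Rightarrow> nat" where
  "edge_weight m k l = (if l = m - k then fact k * fact (m - k) else 0)"

text \<open>For a fixed state the condition on \<sigma> separates over the edges; on each edge the
  permutation must carry the down ends on one side onto the up ends on the other, up to the
  reflection of positions.\<close>

lemma card_edge_perms_transversal:
  assumes "S \<subseteq> X"
  shows "card {\<sigma> \<in> edge_perms E \<gamma>. transversal X (\<beta> \<sigma>) S}
    = (\<Prod>e\<in>E. edge_weight (\<gamma> e) (cnt S (e, False)) (cnt S (e, True)))"
proof -
  let ?P = "\<lambda>e p. \<forall>i<\<gamma> e. ((e, True), \<gamma> e - 1 - p i) \<in> S \<longleftrightarrow> ((e, False), i) \<notin> S"
  have "{\<sigma> \<in> edge_perms E \<gamma>. transversal X (\<beta> \<sigma>) S} = (\<Pi>\<^sub>E e\<in>E. {p. p permutes {..<\<gamma> e} \<and> ?P e p})"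
    using transversal_\<beta>_iff[OF _ assms] by (auto simp: edge_perms_def eperm_def PiE_iff extensional_def)
  then have "card {\<sigma> \<in> edge_perms E \<gamma>. transversal X (\<beta> \<sigma>) S}
      = (\<Prod>e\<in>E. card {p. p permutes {..<\<gamma> e} \<and> ?P e p})"
    by (simp add: card_PiE finE)
  also have "\<dots> = (\<Prod>e\<in>E. edge_weight (\<gamma> e) (cnt S (e, False)) (cnt S (e, True)))"
  proof (rule prod.cong[OF refl])
    fix e assume "e \<in> E"
    have "cnt S (e, False) \<le> \<gamma> e" using cnt_le[of S "(e, False)"] by simp
    then show "card {p. p permutes {..<\<gamma> e} \<and> ?P e p} = edge_weight (\<gamma> e) (cnt S (e, False)) (cnt S (e, True))"
      unfolding card_permutes_matching[where Q = "\<lambda>j. ((e, True), \<gamma> e - 1 - j) \<in> S"] card_reflect card_not_in edge_weight_def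
      by (auto simp: mult.commute)
  qed
  finally show ?thesis .
qed

lemma finite_edge_perms: "finite (edge_perms E \<gamma>)"
  unfolding edge_perms_def by (intro finite_PiE finE finite_permutations) auto

definition states where "states = {S. transversal X \<alpha> S}"

lemma finite_states: "finite states"
  by (rule finite_subset[of _ "Pow X"]) (auto simp: states_def transversal_def finX)

text \<open>Makes \<open>(-1) ^ card (B - S)\<close> a product over the edges that depends only on
  the spin counts.\<close>

lemma card_B_Diff: "card (B - S) = (\<Sum>e\<in>E. \<gamma> e - cnt S (e, False))"
proof -
  have "B - S = (\<lambda>(e, i). ((e, False), i)) ` (SIGMA e:E. {i. i < \<gamma> e \<and> ((e, False), i) \<notin> S})"
    by (auto simp: B_def in_X' image_iff elim!: X_cases)
  then have "card (B - S) = card (SIGMA e:E. {i. i < \<gamma> e \<and> ((e, False), i) \<notin> S})"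
    by (simp add: card_image inj_on_def)
  also have "\<dots> = (\<Sum>e\<in>E. card {i. i < \<gamma> e \<and> ((e, False), i) \<notin> S})"
    by (rule card_SigmaI) (auto intro: finE)
  also have "\<dots> = (\<Sum>e\<in>E. \<gamma> e - cnt S (e, False))"
    by (intro sum.cong refl card_not_in)
  finally show ?thesis .
qed

text \<open>The power of 2 becomes a sum over common transversals, and the power of -1 together with
  the signs of the permutations is given by \<open>loop_sign\<close>. Exchanging the two sums
  leaves, for each state, a count of compatible permutations.\<close>

lemma penrose_state_sum:
  obtains c :: int where "\<bar>c\<bar> = 1"
    "penrose_eval E R \<gamma> = c * (\<Sum>S\<in>states. (-1) ^ card (A - S) *
      (\<Prod>e\<in>E. (-1) ^ (\<gamma> e - cnt S (e, False)) * int (edge_weight (\<gamma> e) (cnt S (e, False)) (cnt S (e, True)))))"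
proof -
  obtain c :: int where c: "\<bar>c\<bar> = 1"
    "\<And>\<sigma> S. eperm \<sigma> \<Longrightarrow> transversal X \<alpha> S \<Longrightarrow> transversal X (\<beta> \<sigma>) S \<Longrightarrow>
      (\<Prod>e\<in>E. sign (\<sigma> e)) * (-1) ^ num_curves E R \<gamma> \<sigma> = c * (-1) ^ card (A - S) * (-1) ^ card (B - S)"
    using loop_sign by blast
  define f where "f S = c * (-1) ^ card (A - S) * (-1) ^ card (B - S)" for S
  have "(\<Prod>e\<in>E. sign (\<sigma> e)) * (-2) ^ num_curves E R \<gamma> \<sigma> =
      (\<Sum>S\<in>states. if transversal X (\<beta> \<sigma>) S then f S else 0)" if "\<sigma> \<in> edge_perms E \<gamma>" for \<sigma>
  proof -
    have \<sigma>: "eperm \<sigma>" using that by (auto simp: edge_perms_def eperm_def)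
    have "(-2::int) ^ num_curves E R \<gamma> \<sigma> = (-1) ^ num_curves E R \<gamma> \<sigma> * 2 ^ num_curves E R \<gamma> \<sigma>"
      by (simp flip: power_mult_distrib)
    also have "2 ^ num_curves E R \<gamma> \<sigma> = int (card {S. transversal X \<alpha> S \<and> transversal X (\<beta> \<sigma>) S})"
      unfolding num_curves_eq[OF \<sigma>] using card_common_transversals[OF finX matching_\<alpha> matching_\<beta>[OF \<sigma>]] by simp
    finally have "(\<Prod>e\<in>E. sign (\<sigma> e)) * (-2) ^ num_curves E R \<gamma> \<sigma> =
        (\<Sum>S | transversal X \<alpha> S \<and> transversal X (\<beta> \<sigma>) S. (\<Prod>e\<in>E. sign (\<sigma> e)) * (-1) ^ num_curves E R \<gamma> \<sigma>)"
      by simp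
    also have "\<dots> = (\<Sum>S | transversal X \<alpha> S \<and> transversal X (\<beta> \<sigma>) S. f S)"
      unfolding f_def by (intro sum.cong refl c(2)[OF \<sigma>]) auto
    also have "\<dots> = (\<Sum>S\<in>{S \<in> states. transversal X (\<beta> \<sigma>) S}. f S)"
      by (rule sum.cong) (auto simp: states_def)
    also have "\<dots> = (\<Sum>S\<in>states. if transversal X (\<beta> \<sigma>) S then f S else 0)"
      by (rule sum.inter_filter[OF finite_states])
    finally show ?thesis .
  qed
  then have "penrose_eval E R \<gamma> = (\<Sum>\<sigma>\<in>edge_perms E \<gamma>. \<Sum>S\<in>states. if transversal X (\<beta> \<sigma>) S then f S else 0)"
    unfolding penrose_eval_def by (rule sum.cong[OF refl])
  also have "\<dots> = (\<Sum>S\<in>states. \<Sum>\<sigma>\<in>edge_perms E \<gamma>. if transversal X (\<beta> \<sigma>) S then f S else 0)"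
    by (rule sum.swap)
  also have "\<dots> = (\<Sum>S\<in>states. f S * int (card {\<sigma> \<in> edge_perms E \<gamma>. transversal X (\<beta> \<sigma>) S}))"
    by (simp add: sum.inter_filter[OF finite_edge_perms, symmetric] mult.commute)
  also have "\<dots> = (\<Sum>S\<in>states. c * ((-1) ^ card (A - S) *
      (\<Prod>e\<in>E. (-1) ^ (\<gamma> e - cnt S (e, False)) * int (edge_weight (\<gamma> e) (cnt S (e, False)) (cnt S (e, True))))))"
  proof (rule sum.cong[OF refl])
    fix S assume "S \<in> states"
    then have "S \<subseteq> X" by (auto simp: states_def transversal_def)
    then show "f S * int (card {\<sigma> \<in> edge_perms E \<gamma>. transversal X (\<beta> \<sigma>) S}) = c * ((-1) ^ card (A - S) *
      (\<Prod>e\<in>E. (-1) ^ (\<gamma> e - cnt S (e, False)) * int (edge_weight (\<gamma> e) (cnt S (e, False)) (cnt S (e, True)))))"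
      by (simp add: f_def card_edge_perms_transversal card_B_Diff power_sum prod.distrib mult_ac)
  qed
  finally show ?thesis using that[OF c(1)] by (simp add: sum_distrib_left)
qed

text \<open>The spin counts at the two ends of an edge are complementary, so the counts at the
  half-edges are determined by one number per edge.\<close>

definition ends :: "('e \<Rightarrow> nat) \<Rightarrow> 'e \<times> bool \<Rightarrow> nat" where
  "ends k h = (if snd h then \<gamma> (fst h) - k (fst h) else k (fst h))"

definition signed_count :: "('e \<times> bool \<Rightarrow> nat) \<Rightarrow> real" where
  "signed_count K = (\<Sum>S | S \<in> states \<and> (\<forall>h\<in>H. cnt S h = K h). (-1) ^ card (A - S))"

text \<open>States are grouped by their counts at the \<open>False\<close> ends. Within a group the
  edge sign is constant, and so is the edge weight wherever it is nonzero, so absolute values are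
  taken only after the alternating sum over the group has been formed.\<close>

lemma penrose_le:
  "\<bar>real_of_int (penrose_eval E R \<gamma>)\<bar> \<le>
    (\<Sum>k\<in>PiE E (\<lambda>e. {..\<gamma> e}). (\<Prod>e\<in>E. fact (k e) * fact (\<gamma> e - k e)) * \<bar>signed_count (ends k)\<bar>)"
proof -
  obtain c :: int where c: "\<bar>c\<bar> = 1"
    "penrose_eval E R \<gamma> = c * (\<Sum>S\<in>states. (-1) ^ card (A - S) *
      (\<Prod>e\<in>E. (-1) ^ (\<gamma> e - cnt S (e, False)) * int (edge_weight (\<gamma> e) (cnt S (e, False)) (cnt S (e, True)))))"
    using penrose_state_sum by blast
  define u where "u S = (-1) ^ card (A - S) *
      (\<Prod>e\<in>E. (-1) ^ (\<gamma> e - cnt S (e, False)) * real (edge_weight (\<gamma> e) (cnt S (e, False)) (cnt S (e, True))))" for S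
  have "real_of_int (penrose_eval E R \<gamma>) = real_of_int c * (\<Sum>S\<in>states. u S)"
    by (simp add: c(2) u_def)
  then have "\<bar>real_of_int (penrose_eval E R \<gamma>)\<bar> = \<bar>\<Sum>S\<in>states. u S\<bar>"
    using c(1) by (simp add: abs_mult flip: of_int_abs)
  also have "(\<Sum>S\<in>states. u S) = (\<Sum>k\<in>PiE E (\<lambda>e. {..\<gamma> e}).
      \<Sum>S | S \<in> states \<and> (\<lambda>e\<in>E. cnt S (e, False)) = k. u S)"
    using cnt_le[of _ "(_, False)"]
    by (intro sum.group [symmetric] finite_states finite_PiE finE) auto
  also have "\<bar>\<dots>\<bar> \<le> (\<Sum>k\<in>PiE E (\<lambda>e. {..\<gamma> e}). \<bar>\<Sum>S | S \<in> states \<and> (\<lambda>e\<in>E. cnt S (e, False)) = k. u S\<bar>)"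
    by (rule sum_abs)
  also have "\<dots> = (\<Sum>k\<in>PiE E (\<lambda>e. {..\<gamma> e}). (\<Prod>e\<in>E. fact (k e) * fact (\<gamma> e - k e)) * \<bar>signed_count (ends k)\<bar>)"
  proof (rule sum.cong[OF refl])
    fix k assume k: "k \<in> PiE E (\<lambda>e. {..\<gamma> e})"
    define s where "s = (\<Prod>e\<in>E. (-1::real) ^ (\<gamma> e - k e))"
    define w where "w = (\<Prod>e\<in>E. fact (k e) * fact (\<gamma> e - k e) :: real)"
    have iff: "(\<forall>h\<in>H. cnt S h = ends k h) \<longleftrightarrow>
        (\<lambda>e\<in>E. cnt S (e, False)) = k \<and> (\<forall>e\<in>E. cnt S (e, True) = \<gamma> e - k e)" for S
    proof -
      have "(\<lambda>e\<in>E. cnt S (e, False)) = k \<longleftrightarrow> (\<forall>e\<in>E. cnt S (e, False) = k e)"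
        using PiE_arb[OF k] by (auto simp: fun_eq_iff restrict_def)
      moreover have "(\<forall>h\<in>H. cnt S h = ends k h) \<longleftrightarrow> (\<forall>e\<in>E. \<forall>s. cnt S (e, s) = ends k (e, s))"
        by (auto simp: half_edges_def)
      ultimately show ?thesis by (auto simp: ends_def all_bool_eq)
    qed
    have u: "u S = s * w * (if \<forall>e\<in>E. cnt S (e, True) = \<gamma> e - k e then (-1) ^ card (A - S) else 0)"
      if "(\<lambda>e\<in>E. cnt S (e, False)) = k" for S
    proof -
      have cF: "cnt S (e, False) = k e" if "e \<in> E" for e
        using that \<open>(\<lambda>e\<in>E. cnt S (e, False)) = k\<close> by auto
      have "u S = (-1) ^ card (A - S) * (s * (\<Prod>e\<in>E. real (edge_weight (\<gamma> e) (k e) (cnt S (e, True)))))"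
        unfolding u_def s_def by (simp add: cF flip: prod.distrib)
      also have "(\<Prod>e\<in>E. real (edge_weight (\<gamma> e) (k e) (cnt S (e, True)))) =
          (if \<forall>e\<in>E. cnt S (e, True) = \<gamma> e - k e then w else 0)"
        using finE by (auto simp: edge_weight_def w_def intro!: prod.cong)
      finally show ?thesis by simp
    qed
    have "(\<Sum>S | S \<in> states \<and> (\<lambda>e\<in>E. cnt S (e, False)) = k. u S) =
       s * w * (\<Sum>S\<in>{S \<in> states. (\<lambda>e\<in>E. cnt S (e, False)) = k}.
          if \<forall>e\<in>E. cnt S (e, True) = \<gamma> e - k e then (-1) ^ card (A - S) else 0)"
      unfolding sum_distrib_left by (intro sum.cong refl u) auto
    also have "(\<Sum>S\<in>{S \<in> states. (\<lambda>e\<in>E. cnt S (e, False)) = k}.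
          if \<forall>e\<in>E. cnt S (e, True) = \<gamma> e - k e then (-1) ^ card (A - S) else 0) = signed_count (ends k)"
      unfolding signed_count_def iff
      by (subst sum.inter_filter [symmetric]) (auto simp: finite_states intro!: sum.cong)
    finally have "\<bar>\<Sum>S | S \<in> states \<and> (\<lambda>e\<in>E. cnt S (e, False)) = k. u S\<bar> = \<bar>s\<bar> * \<bar>w\<bar> * \<bar>signed_count (ends k)\<bar>"
      by (simp only: abs_mult)
    moreover have "\<bar>s\<bar> = 1" by (simp add: s_def abs_prod power_abs)
    moreover have "\<bar>w\<bar> = w" by (simp add: w_def prod_nonneg)
    ultimately show "\<bar>\<Sum>S | S \<in> states \<and> (\<lambda>e\<in>E. cnt S (e, False)) = k. u S\<bar> =
        (\<Prod>e\<in>E. fact (k e) * fact (\<gamma> e - k e)) * \<bar>signed_count (ends k)\<bar>" by (simp add: w_def)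
  qed
  finally show ?thesis .
qed

section \<open>Factorisation over the vertices\<close>

definition base where "base v = (SOME h. h \<in> v)" for v :: "('e \<times> bool) set"

lemma vertex_base:
  assumes "v \<in> vertices E R"
  shows "base v \<in> H" "v = {base v, R (base v), R (R (base v))}"
proof -
  obtain h where h: "h \<in> H" "v = {h, R h, R (R h)}" using assms by (auto simp: vertices_def)
  have "base v \<in> v" unfolding base_def by (rule someI[of _ h]) (simp add: h)
  then show "base v \<in> H" "v = {base v, R (base v), R (R (base v))}"
    using h(1) R_R_R[OF h(1)] R_in[OF h(1)] R_in[OF R_in[OF h(1)]] by (auto simp: h(2))
qed

lemma Union_vertices: "\<Union>(vertices E R) = H"
proof (intro subset_antisym subsetI)
  fix h assume "h \<in> H"
  then have "{h, R h, R (R h)} \<in> vertices E R" unfolding vertices_def by blast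
  then show "h \<in> \<Union>(vertices E R)" by blast
qed (auto simp: vertices_def R_in)

lemma finite_vertices: "finite (vertices E R)"
  by (rule finite_subset[of _ "Pow H"]) (use Union_vertices finH in auto)

lemma disjoint_vertices: "disjoint (vertices E R)"
proof (rule disjointI)
  have eq: "v = {h, R h, R (R h)}" if hv: "v \<in> vertices E R" "h \<in> v" for v h
  proof -
    obtain k where "k \<in> H" "v = {k, R k, R (R k)}" using hv(1) unfolding vertices_def by blast
    with hv(2) R_R_R[of k] show ?thesis by auto
  qed
  fix v w assume "v \<in> vertices E R" "w \<in> vertices E R" "v \<noteq> w"
  then show "v \<inter> w = {}" using eq by blast
qed

lemma prod_vertices:
  fixes f :: "'e \<times> bool \<Rightarrow> 'c::comm_monoid_mult"
  shows "(\<Prod>h\<in>H. f h) = (\<Prod>v\<in>vertices E R. \<Prod>h\<in>v. f h)"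
proof -
  have "prod f (\<Union>(vertices E R)) = (prod \<circ> prod) f (vertices E R)"
  proof (rule prod.Union_disjoint)
    show "\<forall>v\<in>vertices E R. finite v" by (auto simp: vertices_def)
    show "\<forall>v\<in>vertices E R. \<forall>w\<in>vertices E R. v \<noteq> w \<longrightarrow> v \<inter> w = {}"
      using disjoint_vertices by (auto simp: disjoint_def)
  qed
  then show ?thesis by (simp add: Union_vertices)
qed

text \<open>The positions at \<open>h\<close> that belong to \<open>A\<close>; they index the arcs
  from \<open>h\<close> to \<open>R h\<close>.\<close>

definition arcs where "arcs h = {y h..<g h}"

text \<open>A state is freely determined by its restriction to \<open>A\<close>: \<open>d h\<close>
  lists the up ends among the arcs leaving \<open>h\<close>, and an end outside \<open>A\<close>
  takes the spin opposite to that of its partner.\<close>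

definition state_of :: "('e \<times> bool \<Rightarrow> nat set) \<Rightarrow> (('e \<times> bool) \<times> nat) set" where
  "state_of d = {(h, i). (h, i) \<in> X \<and> (if y h \<le> i then i \<in> d h else g (R (R h)) - 1 - i \<notin> d (R (R h)))}"

lemma card_arcs: "h \<in> H \<Longrightarrow> card (arcs h) = z h"
  using yz(2)[of h] by (simp add: arcs_def)

lemma finite_arcs: "finite (arcs h)" by (simp add: arcs_def)

lemma state_of_transversal: "transversal X \<alpha> (state_of d)"
  unfolding transversal_def
proof (intro conjI ballI)
  show "state_of d \<subseteq> X" by (auto simp: state_of_def)
  fix x assume "x \<in> X"
  then obtain h i where x: "x = (h, i)" "h \<in> H" "i < g h" by (cases x) (auto simp: in_X)
  show "\<alpha> x \<in> state_of d \<longleftrightarrow> x \<notin> state_of d"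
  proof (cases "i < y h")
    case True
    then have nle: "\<not> y h \<le> i" by simp
    show ?thesis
      unfolding x(1) using True nle partner_low[OF x(2) True] x(2,3) R_in
      by (simp only: \<alpha>_simp state_of_def in_X if_True if_False mem_Collect_eq prod.case simp_thms)
  next
    case False
    then have hi: "y h \<le> i" by simp
    have nle: "\<not> y (R h) \<le> g h - 1 - i" using partner_high[OF x(2,3) hi] by simp
    show ?thesis
      unfolding x(1) using False hi nle partner_high[OF x(2,3) hi] x(2,3) R_in
      by (simp only: \<alpha>_simp state_of_def in_X if_True if_False mem_Collect_eq prod.case simp_thms R_R_R)
  qed
qed

text \<open>The first summand counts ends of arcs that lead to \<open>R h\<close>; the second counts
  ends of arcs that arrive from \<open>R (R h)\<close>, which are up exactly where the far end is
  down.\<close>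

lemma cnt_state_of:
  assumes d: "d \<in> PiE H (\<lambda>h. Pow (arcs h))" and h: "h \<in> H"
  shows "cnt (state_of d) h = card (d h) + (z (R (R h)) - card (d (R (R h))))"
proof -
  let ?k = "R (R h)"
  have kH: "?k \<in> H" using h R_in by blast
  have dh: "d h \<subseteq> arcs h" "d ?k \<subseteq> arcs ?k" using PiE_mem[OF d h] PiE_mem[OF d kH] by auto
  have eq: "{i. i < g h \<and> (h, i) \<in> state_of d} = d h \<union> {i. i < y h \<and> g ?k - 1 - i \<notin> d ?k}"
    using dh(1) h yz(2)[OF h] by (auto simp: state_of_def in_X arcs_def)
  have "card {i. i < y h \<and> g ?k - 1 - i \<notin> d ?k} = card (arcs ?k - d ?k)"
  proof (rule bij_betw_same_card, rule bij_betw_byWitness[where f = "\<lambda>i. g ?k - 1 - i" and f' = "\<lambda>i. g ?k - 1 - i"])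
    have sz: "y ?k + y h = g ?k" using yz(2)[OF kH] yz(6)[OF h] by simp
    show "\<forall>i\<in>{i. i < y h \<and> g ?k - 1 - i \<notin> d ?k}. g ?k - 1 - (g ?k - 1 - i) = i"
      using sz by auto
    show "\<forall>i\<in>arcs ?k - d ?k. g ?k - 1 - (g ?k - 1 - i) = i" by (auto simp: arcs_def)
    show "(\<lambda>i. g ?k - 1 - i) ` {i. i < y h \<and> g ?k - 1 - i \<notin> d ?k} \<subseteq> arcs ?k - d ?k"
      using sz by (auto simp: arcs_def)
    show "(\<lambda>i. g ?k - 1 - i) ` (arcs ?k - d ?k) \<subseteq> {i. i < y h \<and> g ?k - 1 - i \<notin> d ?k}"
      using sz by (auto simp: arcs_def)
  qed
  also have "\<dots> = z ?k - card (d ?k)"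
    using dh(2) card_arcs[OF kH] finite_subset[OF dh(2) finite_arcs] by (simp add: card_Diff_subset)
  moreover have "card (d h \<union> {i. i < y h \<and> g ?k - 1 - i \<notin> d ?k}) = card (d h) + card {i. i < y h \<and> g ?k - 1 - i \<notin> d ?k}"
    using dh(1) finite_subset[OF dh(1) finite_arcs] by (intro card_Un_disjoint) (auto simp: arcs_def)
  ultimately show ?thesis unfolding cnt_def eq by simp
qed

lemma card_A_Diff:
  assumes d: "d \<in> PiE H (\<lambda>h. Pow (arcs h))"
  shows "card (A - state_of d) = (\<Sum>h\<in>H. z h - card (d h))"
proof -
  have "A - state_of d = (SIGMA h:H. arcs h - d h)"
    by (auto simp: A_def state_of_def in_X arcs_def)
  then have "card (A - state_of d) = (\<Sum>h\<in>H. card (arcs h - d h))"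
    by (simp add: card_SigmaI finH finite_arcs)
  also have "\<dots> = (\<Sum>h\<in>H. z h - card (d h))"
  proof (rule sum.cong[OF refl])
    fix h assume h: "h \<in> H"
    have "d h \<subseteq> arcs h" using PiE_mem[OF d h] by simp
    then show "card (arcs h - d h) = z h - card (d h)"
      using card_arcs[OF h] finite_subset[OF _ finite_arcs] by (simp add: card_Diff_subset)
  qed
  finally show ?thesis .
qed

lemma bij_state_of: "bij_betw state_of (PiE H (\<lambda>h. Pow (arcs h))) states"
proof (rule bij_betw_byWitness[where f' = "\<lambda>S. \<lambda>h\<in>H. {i \<in> arcs h. (h, i) \<in> S}"])
  show "\<forall>d\<in>PiE H (\<lambda>h. Pow (arcs h)). (\<lambda>h\<in>H. {i \<in> arcs h. (h, i) \<in> state_of d}) = d"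
  proof (intro ballI ext)
    fix d h assume d: "d \<in> PiE H (\<lambda>h. Pow (arcs h))"
    show "(\<lambda>h\<in>H. {i \<in> arcs h. (h, i) \<in> state_of d}) h = d h"
    proof (cases "h \<in> H")
      case True
      then show ?thesis using PiE_mem[OF d True] by (auto simp: state_of_def in_X arcs_def)
    qed (use PiE_arb[OF d] in auto)
  qed
  show "\<forall>S\<in>states. state_of (\<lambda>h\<in>H. {i \<in> arcs h. (h, i) \<in> S}) = S"
  proof
    fix S assume "S \<in> states"
    then have S: "S \<subseteq> X" "\<And>x. x \<in> X \<Longrightarrow> \<alpha> x \<in> S \<longleftrightarrow> x \<notin> S"
      by (auto simp: states_def transversal_def)
    have "(h, i) \<in> state_of (\<lambda>h\<in>H. {i \<in> arcs h. (h, i) \<in> S}) \<longleftrightarrow> (h, i) \<in> S"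
      if h: "h \<in> H" "i < g h" for h i
    proof (cases "y h \<le> i")
      case True
      with h show ?thesis by (auto simp: state_of_def in_X arcs_def)
    next
      case False
      then have lt: "i < y h" by simp
      have "(R (R h), g (R (R h)) - 1 - i) \<in> S \<longleftrightarrow> (h, i) \<notin> S"
        using S(2)[of "(h, i)"] h lt by (simp add: \<alpha>_simp in_X)
      with h False partner_low[OF h(1) lt] R_in show ?thesis
        by (simp add: state_of_def in_X arcs_def)
    qed
    then have "x \<in> state_of (\<lambda>h\<in>H. {i \<in> arcs h. (h, i) \<in> S}) \<longleftrightarrow> x \<in> S" if "x \<in> X" for x
      using that by (cases x) (simp add: in_X)
    moreover have "state_of (\<lambda>h\<in>H. {i \<in> arcs h. (h, i) \<in> S}) \<subseteq> X" by (auto simp: state_of_def)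
    ultimately show "state_of (\<lambda>h\<in>H. {i \<in> arcs h. (h, i) \<in> S}) = S"
      using S(1) by blast
  qed
qed (auto simp: states_def state_of_transversal)

text \<open>Only the sizes of the three chosen subsets enter; grouping the subsets by size produces
  the binomial coefficients of \<open>vertex_sum\<close>.\<close>

lemma vertex_sum_eq:
  assumes h: "h \<in> H"
  shows "(\<Sum>d\<in>PiE {h, R h, R (R h)} (\<lambda>h. Pow (arcs h)).
      if \<forall>k\<in>{h, R h, R (R h)}. card (d k) + (z (R (R k)) - card (d (R (R k)))) = K k
      then (\<Prod>k\<in>{h, R h, R (R h)}. (-1) ^ card (d k)) else 0)
    = vertex_sum (z (R h)) (z (R (R h))) (z h) (K h) (K (R h)) (K (R (R h)))"
proof -
  let ?h1 = "R h" and ?h2 = "R (R h)"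
  have H: "?h1 \<in> H" "?h2 \<in> H" using h R_in by auto
  have R_R_R': "R ?h2 = h" "R (R ?h2) = ?h1" using R_R_R[OF h] by auto
  have neq: "h \<noteq> ?h1" "h \<noteq> ?h2" "?h1 \<noteq> ?h2" using R_neq[OF h] R_R_neq[OF h] R_R_neq_R[OF h] by metis+
  define F where "F p q r = (if p + (z ?h2 - r) = K h \<and> q + (z h - p) = K ?h1 \<and> r + (z ?h1 - q) = K ?h2
      then (-1::real) ^ (p + q + r) else 0)" for p q r
  have "(\<Sum>d\<in>PiE {h, ?h1, ?h2} (\<lambda>h. Pow (arcs h)).
      if \<forall>k\<in>{h, ?h1, ?h2}. card (d k) + (z (R (R k)) - card (d (R (R k)))) = K k
      then (\<Prod>k\<in>{h, ?h1, ?h2}. (-1) ^ card (d k)) else 0)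
    = (\<Sum>d\<in>PiE {h, ?h1, ?h2} (\<lambda>h. Pow (arcs h)). F (card (d h)) (card (d ?h1)) (card (d ?h2)))"
    using neq by (intro sum.cong refl) (simp add: F_def R_R_R' power_add mult_ac)
  also have "\<dots> = (\<Sum>a\<in>Pow (arcs h). \<Sum>b\<in>Pow (arcs ?h1). \<Sum>c\<in>Pow (arcs ?h2). F (card a) (card b) (card c))"
    by (rule sum_PiE_three[OF neq])
  also have "\<dots> = (\<Sum>p\<le>z h. real (z h choose p) * (\<Sum>q\<le>z ?h1. real (z ?h1 choose q) *
      (\<Sum>r\<le>z ?h2. real (z ?h2 choose r) * F p q r)))"
  proof -
    have 3: "(\<Sum>c\<in>Pow (arcs ?h2). F p q (card c)) = (\<Sum>r\<le>z ?h2. real (z ?h2 choose r) * F p q r)" for p q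
      using sum_Pow_card[OF finite_arcs[of ?h2], of "F p q"] by (simp add: card_arcs H)
    have 2: "(\<Sum>b\<in>Pow (arcs ?h1). \<Sum>c\<in>Pow (arcs ?h2). F p (card b) (card c)) =
        (\<Sum>q\<le>z ?h1. real (z ?h1 choose q) * (\<Sum>r\<le>z ?h2. real (z ?h2 choose r) * F p q r))" for p
      unfolding 3 using sum_Pow_card[OF finite_arcs[of ?h1], of "\<lambda>q. \<Sum>r\<le>z ?h2. real (z ?h2 choose r) * F p q r"]
      by (simp add: card_arcs H)
    show ?thesis
      unfolding 2 using sum_Pow_card[OF finite_arcs[of h],
        of "\<lambda>p. \<Sum>q\<le>z ?h1. real (z ?h1 choose q) * (\<Sum>r\<le>z ?h2. real (z ?h2 choose r) * F p q r)"]
      by (simp add: card_arcs h)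
  qed
  also have "\<dots> = vertex_sum (z ?h1) (z ?h2) (z h) (K h) (K ?h1) (K ?h2)"
    by (simp add: vertex_sum_def F_def sum_distrib_left mult.assoc)
  finally show ?thesis .
qed

definition local_sum :: "('e \<times> bool \<Rightarrow> nat) \<Rightarrow> ('e \<times> bool) set \<Rightarrow> real" where
  "local_sum K v = (let h = base v in
     vertex_sum (z (R h)) (z (R (R h))) (z h) (K h) (K (R h)) (K (R (R h))))"

text \<open>In terms of the free choices \<open>d\<close>, both the prescribed counts and the sign
  split over the vertices, so the sum becomes a product. Counting up ends in place of down ends
  costs the global sign \<open>(-1) ^ (\<Sum>h\<in>H. z h)\<close>, which the absolute value
  removes.\<close>

lemma abs_signed_count: "\<bar>signed_count K\<bar> = (\<Prod>v\<in>vertices E R. \<bar>local_sum K v\<bar>)"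
proof -
  let ?Q = "PiE H (\<lambda>h. Pow (arcs h))"
  define C where "C v d \<longleftrightarrow> (\<forall>h\<in>v. card (d h) + (z (R (R h)) - card (d (R (R h)))) = K h)"
    for v :: "('e \<times> bool) set" and d :: "'e \<times> bool \<Rightarrow> nat set"
  define F where "F v d = (if C v d then \<Prod>h\<in>v. (-1::real) ^ card (d h) else 0)" for v d
  have "signed_count K = (\<Sum>S\<in>states. if \<forall>h\<in>H. cnt S h = K h then (-1) ^ card (A - S) else 0)"
    unfolding signed_count_def by (rule sum.inter_filter[OF finite_states])
  also have "\<dots> = (\<Sum>d\<in>?Q. if \<forall>h\<in>H. cnt (state_of d) h = K h then (-1) ^ card (A - state_of d) else 0)"
    by (rule sum.reindex_bij_betw[OF bij_state_of, symmetric])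
  also have "\<dots> = (\<Sum>d\<in>?Q. (-1) ^ (\<Sum>h\<in>H. z h) * (\<Prod>v\<in>vertices E R. F v (restrict d v)))"
  proof (rule sum.cong[OF refl])
    fix d assume d: "d \<in> ?Q"
    have le: "card (d h) \<le> z h" if "h \<in> H" for h
      using PiE_mem[OF d that] card_mono[OF finite_arcs[of h], of "d h"] card_arcs[OF that] by simp
    have sgn: "(-1::real) ^ (z h - card (d h)) = (-1) ^ z h * (-1) ^ card (d h)" if "h \<in> H" for h
      using neg_one_power_add_eq_neg_one_power_diff[OF le[OF that], where ?'a = real] by (simp add: power_add)
    \<comment> \<open>The count at \<open>h\<close> involves only the choices at \<open>h\<close>
      and \<open>R (R h)\<close>, which lie on the same vertex.\<close>
    have F: "F v (restrict d v) = F v d" if "v \<in> vertices E R" for v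
    proof -
      have "R (R h) \<in> v" if hv: "h \<in> v" for h
      proof -
        obtain k where "k \<in> H" "v = {k, R k, R (R k)}"
          using \<open>v \<in> vertices E R\<close> unfolding vertices_def by blast
        with hv R_R_R[of k] show ?thesis by auto
      qed
      then have "C v (restrict d v) \<longleftrightarrow> C v d" by (auto simp: C_def)
      then show ?thesis by (auto simp: F_def intro!: prod.cong)
    qed
    have "(\<forall>h\<in>H. cnt (state_of d) h = K h) \<longleftrightarrow> (\<forall>v\<in>vertices E R. C v d)"
    proof -
      have "(\<forall>h\<in>H. cnt (state_of d) h = K h) \<longleftrightarrow> C H d"
        using cnt_state_of[OF d] unfolding C_def by (intro ball_cong refl) simp
      also have "\<dots> \<longleftrightarrow> (\<forall>v\<in>vertices E R. C v d)"
        unfolding C_def Union_vertices [symmetric] by blast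
      finally show ?thesis .
    qed
    moreover have "(-1::real) ^ card (A - state_of d) =
        (-1) ^ (\<Sum>h\<in>H. z h) * (\<Prod>v\<in>vertices E R. \<Prod>h\<in>v. (-1) ^ card (d h))"
      by (simp add: card_A_Diff[OF d] power_sum sgn prod.distrib prod_vertices)
    moreover have "(\<Prod>v\<in>vertices E R. F v d) =
        (if \<forall>v\<in>vertices E R. C v d then \<Prod>v\<in>vertices E R. \<Prod>h\<in>v. (-1) ^ card (d h) else 0)"
      using finite_vertices by (auto simp: F_def intro!: prod.cong)
    ultimately show "(if \<forall>h\<in>H. cnt (state_of d) h = K h then (-1) ^ card (A - state_of d) else 0) =
        (-1) ^ (\<Sum>h\<in>H. z h) * (\<Prod>v\<in>vertices E R. F v (restrict d v))"
      by (simp add: F)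
  qed
  also have "\<dots> = (-1) ^ (\<Sum>h\<in>H. z h) * (\<Sum>d\<in>PiE (\<Union>(vertices E R)) (\<lambda>h. Pow (arcs h)). \<Prod>v\<in>vertices E R. F v (restrict d v))"
    by (simp add: sum_distrib_left Union_vertices)
  also have "(\<Sum>d\<in>PiE (\<Union>(vertices E R)) (\<lambda>h. Pow (arcs h)). \<Prod>v\<in>vertices E R. F v (restrict d v))
      = (\<Prod>v\<in>vertices E R. \<Sum>d\<in>PiE v (\<lambda>h. Pow (arcs h)). F v d)"
    by (rule sum_PiE_Union[OF finite_vertices _ _ disjoint_vertices])
      (auto simp: finite_arcs vertices_def)
  also have "\<dots> = (\<Prod>v\<in>vertices E R. local_sum K v)"
  proof (rule prod.cong[OF refl])
    fix v assume v: "v \<in> vertices E R"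
    define h where "h = base v"
    have h: "h \<in> H" "v = {h, R h, R (R h)}" using vertex_base[OF v] by (simp_all add: h_def)
    show "(\<Sum>d\<in>PiE v (\<lambda>h. Pow (arcs h)). F v d) = local_sum K v"
      unfolding local_sum_def Let_def h_def [symmetric] vertex_sum_eq[OF h(1), symmetric] F_def C_def
      unfolding h(2) ..
  qed
  finally show ?thesis by (simp add: abs_mult power_abs abs_prod)
qed

section \<open>Norm estimate and polynomial bound\<close>

lemma vertex_factor_eq:
  assumes "h \<in> H"
  shows "vertex_factor R \<gamma> h = fact (z (R h) + z (R (R h)) + z h + 1) * fact (z (R h)) * fact (z (R (R h))) * fact (z h)"
proof -
  define a b c where "a = z h" and "b = z (R h)" and "c = z (R (R h))"
  have g: "g h = c + a" "g (R h) = a + b" "g (R (R h)) = b + c"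
    using yz[OF assms] by (auto simp: a_def b_def c_def)
  have "(c + a + (a + b) + (b + c)) div 2 = b + c + a" "(c + a + (a + b) - (b + c)) div 2 = a"
    "(c + a + (b + c) - (a + b)) div 2 = c" "(a + b + (b + c) - (c + a)) div 2 = b" by auto
  then show ?thesis
    by (simp only: vertex_factor_def Let_def g a_def [symmetric] b_def [symmetric] c_def [symmetric])
      (simp only: of_nat_mult of_nat_fact mult_ac)
qed

lemma vertex_factor_pos: "h \<in> H \<Longrightarrow> vertex_factor R \<gamma> h > 0"
  by (simp add: vertex_factor_eq)

lemma local_sum_le:
  assumes v: "v \<in> vertices E R" and K: "\<And>h. h \<in> H \<Longrightarrow> K h \<le> g h"
  shows "\<bar>local_sum K v\<bar> * (\<Prod>h\<in>v. sqrt (fact (K h) * fact (g h - K h))) \<le> sqrt (vertex_factor R \<gamma> (base v))"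
proof -
  define h where "h = base v"
  have h: "h \<in> H" "v = {h, R h, R (R h)}" using vertex_base[OF v] by (simp_all add: h_def)
  have H: "R h \<in> H" "R (R h) \<in> H" using h R_in by auto
  have neq: "h \<noteq> R h" "h \<noteq> R (R h)" "R h \<noteq> R (R h)" using R_neq[OF h(1)] R_R_neq[OF h(1)] R_R_neq_R[OF h(1)] by metis+
  have g: "g h = z (R (R h)) + z h" "g (R h) = z (R h) + z h" "g (R (R h)) = z (R h) + z (R (R h))"
    using yz[OF h(1)] by auto
  show ?thesis
    using vertex_sum_bound[of "K h" "z (R (R h))" "z h" "K (R h)" "z (R h)" "K (R (R h))"]
      K[OF h(1)] K[OF H(1)] K[OF H(2)] neq
    unfolding local_sum_def Let_def h_def [symmetric] vertex_factor_eq[OF h(1)]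
    unfolding h(2) g by (simp add: g mult.assoc)
qed

lemma penrose_bound:
  "\<bar>real_of_int (penrose_eval E R \<gamma>)\<bar> \<le> (\<Prod>e\<in>E. real (\<gamma> e + 1)) * (\<Prod>v\<in>vertices E R. sqrt (vertex_factor R \<gamma> (base v)))"
proof -
  have "(\<Prod>e\<in>E. fact (k e) * fact (\<gamma> e - k e)) * \<bar>signed_count (ends k)\<bar>
      \<le> (\<Prod>v\<in>vertices E R. sqrt (vertex_factor R \<gamma> (base v)))" if k: "k \<in> PiE E (\<lambda>e. {..\<gamma> e})" for k
  proof -
    \<comment> \<open>The two ends of an edge have complementary counts and therefore the same
      weight \<open>fact (k e) * fact (\<gamma> e - k e)\<close>. Its square root at each end
      restores the edge factor exactly and lets the vertices be estimated separately.\<close>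
    have "(\<Prod>h\<in>H. sqrt (fact (ends k h) * fact (g h - ends k h))) =
        (\<Prod>e\<in>E. \<Prod>s\<in>UNIV. sqrt (fact (ends k (e, s)) * fact (\<gamma> e - ends k (e, s))))"
      unfolding half_edges_def by (subst prod.cartesian_product) (auto intro!: prod.cong)
    also have "\<dots> = (\<Prod>e\<in>E. fact (k e) * fact (\<gamma> e - k e))"
    proof (rule prod.cong[OF refl])
      fix e assume "e \<in> E"
      then have "k e \<le> \<gamma> e" using PiE_mem[OF k] by auto
      then show "(\<Prod>s\<in>UNIV. sqrt (fact (ends k (e, s)) * fact (\<gamma> e - ends k (e, s)))) = fact (k e) * fact (\<gamma> e - k e)"
        by (simp add: UNIV_bool ends_def mult.commute)
    qed
    finally have "(\<Prod>e\<in>E. fact (k e) * fact (\<gamma> e - k e)) * \<bar>signed_count (ends k)\<bar> =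
        (\<Prod>v\<in>vertices E R. \<bar>local_sum (ends k) v\<bar> * (\<Prod>h\<in>v. sqrt (fact (ends k h) * fact (g h - ends k h))))"
      by (simp add: abs_signed_count prod.distrib prod_vertices mult.commute)
    also have "\<dots> \<le> (\<Prod>v\<in>vertices E R. sqrt (vertex_factor R \<gamma> (base v)))"
    proof (rule prod_mono, intro conjI)
      have "ends k h \<le> g h" if "h \<in> H" for h
        using that PiE_mem[OF k, of "fst h"] by (auto simp: ends_def half_edges_def)
      then show "\<bar>local_sum (ends k) v\<bar> * (\<Prod>h\<in>v. sqrt (fact (ends k h) * fact (g h - ends k h)))
          \<le> sqrt (vertex_factor R \<gamma> (base v))" if "v \<in> vertices E R" for v
        using that by (rule local_sum_le[rotated])
    qed (auto intro!: mult_nonneg_nonneg prod_nonneg)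
    finally show ?thesis .
  qed
  then have "\<bar>real_of_int (penrose_eval E R \<gamma>)\<bar> \<le>
      (\<Sum>k\<in>PiE E (\<lambda>e. {..\<gamma> e}). \<Prod>v\<in>vertices E R. sqrt (vertex_factor R \<gamma> (base v)))"
    by (intro order_trans[OF penrose_le] sum_mono) auto
  \<comment> \<open>The summand no longer depends on \<open>k\<close>, and each \<open>k e\<close>
    takes \<open>\<gamma> e + 1\<close> values.\<close>
  then show ?thesis by (simp add: card_PiE finE)
qed

lemma unitary_bound: "\<bar>unitary_eval E R \<gamma>\<bar> \<le> (\<Prod>e\<in>E. real (\<gamma> e + 1))"
proof -
  let ?V = "\<lambda>v. vertex_factor R \<gamma> (base v)"
  have pos: "?V v > 0" if "v \<in> vertices E R" for v
    using vertex_factor_pos vertex_base(1)[OF that] by blast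
  have "\<bar>unitary_eval E R \<gamma>\<bar> = \<bar>real_of_int (penrose_eval E R \<gamma>)\<bar> * (\<Prod>v\<in>vertices E R. ?V v powr (-1/2))"
    by (simp add: unitary_eval_def base_def abs_mult abs_prod)
  also have "\<dots> \<le> (\<Prod>e\<in>E. real (\<gamma> e + 1)) * (\<Prod>v\<in>vertices E R. sqrt (?V v)) * (\<Prod>v\<in>vertices E R. ?V v powr (-1/2))"
    by (intro mult_right_mono penrose_bound prod_nonneg) auto
  also have "(\<Prod>e\<in>E. real (\<gamma> e + 1)) * (\<Prod>v\<in>vertices E R. sqrt (?V v)) * (\<Prod>v\<in>vertices E R. ?V v powr (-1/2))
      = (\<Prod>e\<in>E. real (\<gamma> e + 1)) * (\<Prod>v\<in>vertices E R. sqrt (?V v) * ?V v powr (-1/2))"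
    by (simp only: prod.distrib mult.assoc)
  also have "(\<Prod>v\<in>vertices E R. sqrt (?V v) * ?V v powr (-1/2)) = 1"
  proof (rule prod.neutral, rule ballI)
    fix v assume "v \<in> vertices E R"
    from pos[OF this] show "sqrt (?V v) * ?V v powr (-1/2) = 1"
      by (simp add: powr_half_sqrt [symmetric] flip: powr_add)
  qed
  finally show ?thesis by simp
qed

end

lemma spin_network_scale:
  assumes "spin_network E R \<gamma>"
  shows "spin_network E R (\<lambda>e. n * \<gamma> e)"
proof -
  have "even (n * a + n * b + n * c) \<and> \<bar>int (n * a) - int (n * b)\<bar> \<le> int (n * c) \<and> n * c \<le> n * a + n * b"
    if "even (a + b + c)" "\<bar>int a - int b\<bar> \<le> int c" "c \<le> a + b" for a b c
  proof (intro conjI)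
    show "even (n * a + n * b + n * c)" using that(1) by (simp flip: distrib_left)
    have "\<bar>int (n * a) - int (n * b)\<bar> = int n * \<bar>int a - int b\<bar>"
      by (simp add: abs_mult flip: right_diff_distrib)
    with that(2) show "\<bar>int (n * a) - int (n * b)\<bar> \<le> int (n * c)"
      by (simp add: mult_left_mono)
    show "n * c \<le> n * a + n * b" using that(3) by (simp flip: distrib_left)
  qed
  with assms show ?thesis by (auto simp: spin_network_def admissible_def Let_def)
qed

theorem theorem2:
  fixes E :: "'e set" and R :: "'e \<times> bool \<Rightarrow> 'e \<times> bool" and \<gamma> :: "'e \<Rightarrow> nat"
  assumes "spin_network E R \<gamma>"
  shows "\<exists>C::real > 0. \<exists>k::real \<ge> 0. \<forall>n::nat.
           \<bar>unitary_eval E R (\<lambda>e. n * \<gamma> e)\<bar> \<le> C * (1 + real n) powr k"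
proof (intro exI conjI allI)
  \<comment> \<open>Each factor \<open>n * \<gamma> e + 1\<close> of \<open>unitary_bound\<close> is
    at most \<open>(1 + \<gamma> e) * (1 + n)\<close>, which gives this constant and the exponent
    \<open>card E\<close>.\<close>
  show "(\<Prod>e\<in>E. 1 + real (\<gamma> e)) > 0" by (rule prod_pos) simp
  show "real (card E) \<ge> 0" by simp
  fix n :: nat
  interpret spin E R "\<lambda>e. n * \<gamma> e"
    by unfold_locales (rule spin_network_scale[OF assms])
  have "\<bar>unitary_eval E R (\<lambda>e. n * \<gamma> e)\<bar> \<le> (\<Prod>e\<in>E. real (n * \<gamma> e + 1))"
    by (rule unitary_bound)
  also have "\<dots> \<le> (\<Prod>e\<in>E. (1 + real (\<gamma> e)) * (1 + real n))"
    by (intro prod_mono) (auto simp: algebra_simps)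
  also have "\<dots> = (\<Prod>e\<in>E. 1 + real (\<gamma> e)) * (1 + real n) powr real (card E)"
    by (simp add: prod.distrib powr_realpow)
  finally show "\<bar>unitary_eval E R (\<lambda>e. n * \<gamma> e)\<bar> \<le> (\<Prod>e\<in>E. 1 + real (\<gamma> e)) * (1 + real n) powr real (card E)" .
qed

end
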